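(* Let $N=\{1,2,\ldots,n\}$ and let $f_1,f_2:\mathbb{Z}^N\to\mathbb{R}\cup\{+\infty\}$ be jump M$^\natural$-convex functions. Let $f_1\Box f_2:\mathbb{Z}^N\to\mathbb{R}\cup\{+\infty,-\infty\}$ be their (infimum) convolution, $$(f_1\Box f_2)(x)=\inf\{f_1(x_1)+f_2(x_2)\mid x_1+x_2=x,\ x_1\in\mathbb{Z}^N,\ x_2\in\mathbb{Z}^N\}.$$ If $f_1\Box f_2$ does not take the value $-\infty$, then $f_1\Box f_2$ is jump M$^\natural$-convex.
   Context: For a finite index set $N$ and a function $f:\mathbb{Z}^N\to\mathbb{R}\cup\{+\infty\}$, the effective domain is $\operatorname{dom} f=\{x\in\mathbb{Z}^N\mid f(x)<+\infty\}$; it is always assumed to be nonempty. $\mathbf{1}^i$ denotes the $i$th unit vector. For integer vectors $x,y$, let $x\vee y$ and $x\wedge y$ be the componentwise maximum and minimum, and $[x\wedge y,x\vee y]_{\mathbb{Z}}$ the set of integer vectors $z$ with $x\wedge y\le z\le x\vee y$ componentwise. A vector $s\in\mathbb{Z}^N$ is an $(x,y)$-increment if $s=\mathbf{1}^i$ or $s=-\mathbf{1}^i$ for some $i\in N$ and $x+s\in[x\wedge y,x\vee y]_{\mathbb{Z}}$. A function $f$ is jump M$^\natural$-convex if it satisfies (JM$^\natural$-EXC): for any $x,y\in\operatorname{dom} f$ and any $(x,y)$-increment $s$, (i) or (ii) holds: (i) $x+s\in\operatorname{dom} f$, $y-s\in\operatorname{dom} f$, and $f(x)+f(y)\ge f(x+s)+f(y-s)$;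 (ii) there exists an $(x+s,y)$-increment $t$ such that $x+s+t\in\operatorname{dom} f$, $y-s-t\in\operatorname{dom} f$, and $f(x)+f(y)\ge f(x+s+t)+f(y-s-t)$. *)

theory Defs
  imports "HOL-Analysis.Analysis"
begin

text \<open>
  Vectors in \<open>\<int>\<^sup>N\<close> are rendered as \<open>int ^ 'n\<close>, the finite type \<open>'n\<close> playing the role of the
  index set \<open>N = {1, ..., n}\<close>; the order on \<open>int ^ 'n\<close> is the componentwise one.
  Functions take values in \<open>ereal\<close>; that \<open>-\<infinity>\<close> is not a value of \<open>f\<close> is part of
  \<open>jump_Mnat_convex f\<close>, as is nonemptiness of the effective domain.
\<close>

definition eff_dom :: "(int ^ 'n \<Rightarrow> ereal) \<Rightarrow> (int ^ 'n) set" where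
  "eff_dom f = {x. f x < \<infinity>}"

definition vec_join :: "int ^ 'n \<Rightarrow> int ^ 'n \<Rightarrow> int ^ 'n" where
  "vec_join x y = (\<chi> i. max (x $ i) (y $ i))"

definition vec_meet :: "int ^ 'n \<Rightarrow> int ^ 'n \<Rightarrow> int ^ 'n" where
  "vec_meet x y = (\<chi> i. min (x $ i) (y $ i))"

definition is_increment :: "int ^ 'n \<Rightarrow> int ^ 'n \<Rightarrow> int ^ 'n \<Rightarrow> bool" where
  "is_increment x y s \<longleftrightarrow>
     (\<exists>i. s = axis i 1 \<or> s = - axis i 1) \<and> x + s \<in> {vec_meet x y..vec_join x y}"

definition JMnat_EXC :: "(int ^ 'n \<Rightarrow> ereal) \<Rightarrow> bool" where
  "JMnat_EXC f \<longleftrightarrow>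
     (\<forall>x \<in> eff_dom f. \<forall>y \<in> eff_dom f. \<forall>s. is_increment x y s \<longrightarrow>
        (x + s \<in> eff_dom f \<and> y - s \<in> eff_dom f \<and> f x + f y \<ge> f (x + s) + f (y - s)) \<or>
        (\<exists>t. is_increment (x + s) y t \<and>
             x + s + t \<in> eff_dom f \<and> y - s - t \<in> eff_dom f \<and>
             f x + f y \<ge> f (x + s + t) + f (y - s - t)))"

definition jump_Mnat_convex :: "(int ^ 'n \<Rightarrow> ereal) \<Rightarrow> bool" where
  "jump_Mnat_convex f \<longleftrightarrow> (\<forall>x. f x \<noteq> -\<infinity>) \<and> eff_dom f \<noteq> {} \<and> JMnat_EXC f"

text \<open>
  The sum is never of the form \<open>\<infinity> + (-\<infinity>)\<close> when \<open>f1\<close> and \<open>f2\<close> avoid \<open>-\<infinity>\<close>.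
\<close>

definition inf_convolution ::
    "(int ^ 'n \<Rightarrow> ereal) \<Rightarrow> (int ^ 'n \<Rightarrow> ereal) \<Rightarrow> int ^ 'n \<Rightarrow> ereal" where
  "inf_convolution f1 f2 x = Inf {f1 x1 + f2 x2 | x1 x2. x1 + x2 = x}"

end

theory Submission
  imports Defs
begin

text \<open>
  Call \<open>x\<close> and \<open>y\<close> the two points of the effective domain of the convolution, and fix
  representations \<open>x = x1 + x2\<close>, \<open>y = y1 + y2\<close>. The heart of the matter is
  \<open>exchange_of_representations\<close>: some step \<open>t\<close> (possibly zero) admits representations
  \<open>u1 + u2\<close> of \<open>x + s + t\<close> and \<open>v1 + v2\<close> of \<open>y - s - t\<close> of total value at most
  \<open>f1 x1 + f2 x2 + f1 y1 + f2 y2\<close>. As only finitely many \<open>t\<close> are possible, one of them works for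
  representations whose values approach the two infima, so the infima need not be attained.

  To prove it, cut the segment from \<open>x1\<close> to \<open>y1\<close> and the one from \<open>x2\<close> to \<open>y2\<close> into signed unit
  steps, one element for each. Subsets of the resulting finite set parametrize pairs of vectors
  between \<open>(x1, x2)\<close> and \<open>(y1, y2)\<close>, and the sum of \<open>f1\<close> and \<open>f2\<close> becomes a real function on a
  family of sets with an exchange property: flipping \<open>i\<close> in both \<open>A\<close> and \<open>B\<close>
  is repaired by flipping at most one further \<open>j\<close> (\<open>natural_exchange_split\<close>,
  \<open>natural_exchange_product\<close>). Adding one element that records parity makes the number of flips
  exactly two (\<open>even_exchange_evenize\<close>); the result is a valuated even delta-matroid. Two elements
  whose steps cancel in the sum \<open>x1 + x2\<close> can be projected away: minimizing over the presence of
  both or of neither keeps the exchange property (\<open>even_exchange_contract\<close>). Once no cancelling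
  pair is left, every element \<open>j\<close> that can accompany a given \<open>i\<close> is a step from \<open>x + s\<close> towards
  \<open>y\<close>, or the parity element, which does not move the vector.

  Both closure results for set functions are obtained by induction on the distance
  \<open>card (A \<triangle> B)\<close> and rest on two facts. The first (\<open>exchange_step\<close>) is a passage from local to
  global: for distance at least 6, exchange for all closer pairs, and existence of
  one set \<open>A \<triangle> {i, j}\<close> in the family, give exchange for \<open>A\<close> and \<open>B\<close>. The second
  (\<open>four_point_lemma\<close>) settles distance 4: after adding a suitable linear function, the values on
  the pairs exceed the two end values, and then a minimizer over the odd sets contradicts the
  exchange property.
\<close>

section \<open>Symmetric differences\<close>

text \<open>
  Symmetric difference, as a constant so that the simplifier handles it through membership.
\<close>

definition sd :: "'e set \<Rightarrow> 'e set \<Rightarrow> 'e set" (infixl "\<triangle>" 65) where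
  "A \<triangle> B = (A - B) \<union> (B - A)"

lemma mem_sd [simp]: "x \<in> A \<triangle> B \<longleftrightarrow> (x \<in> A) \<noteq> (x \<in> B)"
  by (auto simp: sd_def)

lemma sd_assoc: "(A \<triangle> B) \<triangle> C = A \<triangle> (B \<triangle> C)"
  by (auto simp: set_eq_iff)

lemma sd_commute: "A \<triangle> B = B \<triangle> A"
  by (auto simp: set_eq_iff)

lemma sd_self [simp]: "A \<triangle> A = {}" "A \<triangle> (A \<triangle> B) = B"
  "{} \<triangle> A = A" "A \<triangle> {} = A"
  by (auto simp: set_eq_iff)

lemma sd_cancel [simp]: "(T \<triangle> A) \<triangle> (T \<triangle> B) = A \<triangle> B"
  by (auto simp: set_eq_iff)

lemma finite_sd [simp]: "finite A \<Longrightarrow> finite B \<Longrightarrow> finite (A \<triangle> B)"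
  by (simp add: sd_def)

lemma even_card_sd:
  assumes "finite A" "finite B"
  shows "even (card (A \<triangle> B)) \<longleftrightarrow> (even (card A) \<longleftrightarrow> even (card B))"
proof -
  have "card (A \<triangle> B) = card (A - B) + card (B - A)"
    unfolding sd_def using assms by (intro card_Un_disjoint) auto
  moreover have "card A = card (A - B) + card (A \<inter> B)"
    by (metis assms(1) card_Diff_subset_Int add.commute le_add_diff_inverse card_mono finite_Int inf_le1 Int_lower1)
  moreover have "card B = card (B - A) + card (A \<inter> B)"
    by (metis assms(2) card_Diff_subset_Int add.commute le_add_diff_inverse card_mono finite_Int inf_commute inf_le1)
  ultimately show ?thesis by auto
qed

section \<open>Exchange properties of functions on families of sets\<close>

text \<open>
  Flipping \<open>i\<close> and \<open>j\<close> in both \<open>A\<close> and \<open>B\<close> stays in the family \<open>D\<close> and does not increase the sum of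
  the values. For \<open>i = j\<close> a single element is flipped. The values of \<open>f\<close> outside \<open>D\<close>
  are irrelevant; \<open>D\<close> plays the role of the effective domain.
\<close>

definition exch :: "'e set set \<Rightarrow> ('e set \<Rightarrow> real) \<Rightarrow> 'e set \<Rightarrow> 'e set \<Rightarrow> 'e \<Rightarrow> 'e \<Rightarrow> bool" where
  "exch D f A B i j \<longleftrightarrow> A \<triangle> {i, j} \<in> D \<and> B \<triangle> {i, j} \<in> D \<and>
     f (A \<triangle> {i, j}) + f (B \<triangle> {i, j}) \<le> f A + f B"

text \<open>
  Valuated even delta-matroids: all members have the same parity, and two distinct elements
  are flipped.
\<close>

definition even_exchange :: "'e set set \<Rightarrow> ('e set \<Rightarrow> real) \<Rightarrow> bool" where
  "even_exchange D f \<longleftrightarrow>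
     (\<forall>A\<in>D. finite A) \<and> (\<forall>A\<in>D. \<forall>B\<in>D. even (card (A \<triangle> B))) \<and>
     (\<forall>A\<in>D. \<forall>B\<in>D. \<forall>i\<in>A \<triangle> B. \<exists>j\<in>A \<triangle> B - {i}. exch D f A B i j)"

text \<open>
  The variant without parity, the binary counterpart of jump M-natural-convexity: \<open>j = i\<close> is allowed.
\<close>

definition natural_exchange :: "'e set set \<Rightarrow> ('e set \<Rightarrow> real) \<Rightarrow> bool" where
  "natural_exchange D f \<longleftrightarrow>
     (\<forall>A\<in>D. finite A) \<and>
     (\<forall>A\<in>D. \<forall>B\<in>D. \<forall>i\<in>A \<triangle> B. \<exists>j\<in>A \<triangle> B. exch D f A B i j)"

text \<open>
  The family \<open>D\<close> seen from \<open>T\<close>: twisting by a member \<open>T\<close> moves it to the empty set.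
\<close>

definition twist :: "'e set \<Rightarrow> 'e set set \<Rightarrow> 'e set set" where
  "twist T D = {X. T \<triangle> X \<in> D}"

lemma exch_twist: "exch (twist T D) (\<lambda>X. f (T \<triangle> X)) A B i j \<longleftrightarrow> exch D f (T \<triangle> A) (T \<triangle> B) i j"
  by (simp add: exch_def twist_def sd_assoc)

lemma exch_twist': "exch D f A B i j \<longleftrightarrow> exch (twist A D) (\<lambda>X. f (A \<triangle> X)) {} (A \<triangle> B) i j"
  by (simp add: exch_twist)

lemma exch_nested:
  assumes "A \<subseteq> B" "i \<in> B - A" "j \<in> B - A"
  shows "exch D f A B i j \<longleftrightarrow> A \<union> {i, j} \<in> D \<and> B - {i, j} \<in> D \<and>
     f (A \<union> {i, j}) + f (B - {i, j}) \<le> f A + f B"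
proof -
  have "A \<triangle> {i, j} = A \<union> {i, j}" "B \<triangle> {i, j} = B - {i, j}"
    using assms by (auto simp: set_eq_iff)
  then show ?thesis by (simp add: exch_def)
qed

text \<open>
  The step from local to global, for the pair of the empty set and \<open>E\<close>. If exchange fails at \<open>i\<close>,
  there are numbers \<open>q j\<close> with \<open>f {i, j} = - q j\<close> and \<open>f (E - {i, j}) > q j + f {} + f E\<close> wherever
  these sets lie in the family. Take \<open>k\<close>, \<open>l\<close> different from \<open>i\<close> such that
  \<open>f (E - {k, l}) - q k - q l\<close> is minimal; exchange at \<open>i\<close> for the closer pairs
  \<open>{}, E - {k, l}\<close> and \<open>E - {i, j, k, l}, E\<close> produces a smaller value or an exchange at \<open>i\<close>.
\<close>

lemma exchange_nested_step:
  fixes f :: "'e set \<Rightarrow> real"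
  assumes fin: "finite E" and "card E \<ge> 6" and D0: "{} \<in> D" and DE: "E \<in> D" and i: "i \<in> E"
    and IH: "\<And>A B k. A \<in> D \<Longrightarrow> B \<in> D \<Longrightarrow> A \<subseteq> B \<Longrightarrow> card (B - A) < card E \<Longrightarrow> B \<subseteq> E \<Longrightarrow> k \<in> B - A \<Longrightarrow>
       \<exists>j\<in>B - A - {k}. A \<union> {k, j} \<in> D \<and> B - {k, j} \<in> D \<and> f (A \<union> {k, j}) + f (B - {k, j}) \<le> f A + f B"
    and one: "\<exists>j\<in>E - {i}. {i, j} \<in> D"
  shows "\<exists>j\<in>E - {i}. {i, j} \<in> D \<and> E - {i, j} \<in> D \<and> f {i, j} + f (E - {i, j}) \<le> f {} + f E"
proof (rule ccontr)
  define c where "c = f {} + f E"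
  assume "\<not> ?thesis"
  then have fail: "f {i, j} + f (E - {i, j}) > c"
    if "j \<in> E - {i}" "{i, j} \<in> D" "E - {i, j} \<in> D" for j
    using that unfolding c_def by force
  \<comment> \<open>If {i, j} lies outside the family, any sufficiently small value serves.\<close>
  define q where "q j = (if {i, j} \<in> D then - f {i, j} else f (E - {i, j}) - c - 1)" for j
  have q1: "f {i, j} = - q j" if "{i, j} \<in> D" for j using that by (simp add: q_def)
  have q2: "f (E - {i, j}) > q j + c" if "j \<in> E - {i}" "E - {i, j} \<in> D" for j
    using that fail[of j] by (auto simp: q_def)
  define K where "K = {(k, l). k \<in> E - {i} \<and> l \<in> E - {i} \<and> k \<noteq> l \<and> E - {k, l} \<in> D}"
  have "finite K"
    by (rule finite_subset[of _ "E \<times> E"]) (use fin in \<open>auto simp: K_def\<close>)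
  \<comment> \<open>Exchange for the closer pair {i, k}, E yields a member E - {l, m} with l, m different from i.\<close>
  moreover have "K \<noteq> {}"
  proof -
    obtain k where k: "k \<in> E - {i}" "{i, k} \<in> D" using one by blast
    have ck: "card (E - {i, k}) = card E - 2"
      using k i fin by (subst card_Diff_subset) auto
    have "card (E - {i, k}) \<noteq> 0" using ck assms(2) by linarith
    then have "E - {i, k} \<noteq> {}" by (metis card.empty)
    then obtain l where "l \<in> E - {i, k}" by blast
    then obtain m where "m \<in> E - {i, k} - {l}" "E - {l, m} \<in> D"
      using IH[of "{i, k}" E l] k i DE ck assms(2) by auto
    then have "(l, m) \<in> K" using \<open>l \<in> E - {i, k}\<close> by (auto simp: K_def)
    then show ?thesis by blast
  qed
  ultimately obtain k l where kl: "(k, l) \<in> K"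
    and mn: "\<And>k' l'. (k', l') \<in> K \<Longrightarrow> f (E - {k, l}) - q k - q l \<le> f (E - {k', l'}) - q k' - q l'"
    using ex_is_arg_min_if_finite[of K "\<lambda>(k, l). f (E - {k, l}) - q k - q l"]
    by (fastforce simp: is_arg_min_linorder)
  have kl': "k \<in> E" "l \<in> E" "k \<noteq> i" "l \<noteq> i" "k \<noteq> l" "E - {k, l} \<in> D" using kl by (auto simp: K_def)
  have "card (E - {k, l}) < card E"
    using kl' fin by (intro psubset_card_mono) auto
  then obtain j where j: "j \<in> E - {k, l} - {i}" "{i, j} \<in> D" "E - {k, l} - {i, j} \<in> D"
    and ineq1: "f {i, j} + f (E - {k, l} - {i, j}) \<le> f {} + f (E - {k, l})"
    using IH[of "{}" "E - {k, l}" i] kl' i D0 by auto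
  define R where "R = E - {k, l} - {i, j}"
  have ER: "E - R = {i, j, k, l}" using kl' i j(1) by (auto simp: R_def)
  have "card (E - R) < card E" unfolding ER using assms(2) card_length[of "[i, j, k, l]"] by simp
  then obtain m where m: "m \<in> E - R - {i}" "R \<union> {i, m} \<in> D" "E - {i, m} \<in> D"
    and ineq2: "f (R \<union> {i, m}) + f (E - {i, m}) \<le> f R + f E"
    using IH[of R E i] DE j i ER by (auto simp: R_def)
  have "m = j \<or> m = k \<or> m = l" using m(1) ER by auto
  then show False
  proof (elim disjE)
    assume "m = j"
    then have "R \<union> {i, m} = E - {k, l}" using i j kl' by (auto simp: R_def)
    then show False using ineq1 ineq2 q1[OF j(2)] q2[of j] j m \<open>m = j\<close> unfolding c_def R_def by auto
  next
    assume mk: "m = k"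
    then have *: "R \<union> {i, m} = E - {j, l}" using i j kl' by (auto simp: R_def)
    then have "(j, l) \<in> K" using m j kl' by (auto simp: K_def)
    from mn[OF this] show False
      using ineq1 ineq2 q1[OF j(2)] q2[of k] j m mk kl' unfolding c_def * R_def[symmetric] by auto
  next
    assume ml: "m = l"
    then have *: "R \<union> {i, m} = E - {k, j}" using i j kl' by (auto simp: R_def)
    then have "(k, j) \<in> K" using m j kl' by (auto simp: K_def)
    from mn[OF this] show False
      using ineq1 ineq2 q1[OF j(2)] q2[of l] j m ml kl' unfolding c_def * R_def[symmetric] by auto
  qed
qed

text \<open>
  The same step for an arbitrary pair \<open>A\<close>, \<open>B\<close>, by twisting with \<open>A\<close>. The last hypothesis
  concerns only the family, and only one of the two sets.
\<close>

lemma exchange_step: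
  fixes f :: "'e set \<Rightarrow> real"
  assumes fin: "finite (A \<triangle> B)" and "card (A \<triangle> B) \<ge> 6" and A: "A \<in> D" and B: "B \<in> D"
    and i: "i \<in> A \<triangle> B"
    and IH: "\<And>S T k. S \<in> D \<Longrightarrow> T \<in> D \<Longrightarrow> card (S \<triangle> T) < card (A \<triangle> B) \<Longrightarrow> k \<in> S \<triangle> T \<Longrightarrow>
       \<exists>j\<in>S \<triangle> T - {k}. exch D f S T k j"
    and one: "\<exists>j\<in>A \<triangle> B - {i}. A \<triangle> {i, j} \<in> D"
  shows "\<exists>j\<in>A \<triangle> B - {i}. exch D f A B i j"
proof -
  define E where "E = A \<triangle> B"
  have "\<exists>j\<in>E - {i}. {i, j} \<in> twist A D \<and> E - {i, j} \<in> twist A D \<and>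
     f (A \<triangle> {i, j}) + f (A \<triangle> (E - {i, j})) \<le> f (A \<triangle> {}) + f (A \<triangle> E)"
  proof (rule exchange_nested_step)
    fix S T k assume *: "S \<in> twist A D" "T \<in> twist A D" "S \<subseteq> T" "card (T - S) < card E" "k \<in> T - S"
    have TS: "S \<triangle> T = T - S" using *(3) by (auto simp: set_eq_iff)
    have "\<exists>j\<in>(A \<triangle> S) \<triangle> (A \<triangle> T) - {k}. exch D f (A \<triangle> S) (A \<triangle> T) k j"
      using * IH[of "A \<triangle> S" "A \<triangle> T" k] TS unfolding twist_def E_def by (metis mem_Collect_eq sd_cancel)
    then obtain j where j: "j \<in> T - S - {k}" "exch (twist A D) (\<lambda>X. f (A \<triangle> X)) S T k j"
      by (auto simp: exch_twist simp del: mem_sd simp: TS)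
    then show "\<exists>j\<in>T - S - {k}. S \<union> {k, j} \<in> twist A D \<and> T - {k, j} \<in> twist A D \<and>
        f (A \<triangle> (S \<union> {k, j})) + f (A \<triangle> (T - {k, j})) \<le> f (A \<triangle> S) + f (A \<triangle> T)"
      using exch_nested[of S T k j "twist A D" "\<lambda>X. f (A \<triangle> X)"] * by blast
  qed (use assms in \<open>auto simp: E_def twist_def simp del: mem_sd\<close>)
  then show ?thesis
    using exch_nested[of "{}" E i _ "twist A D" "\<lambda>X. f (A \<triangle> X)"] i
    unfolding exch_twist'[of D f A B] E_def[symmetric] by auto
qed

section \<open>Exchange at small distance\<close>

text \<open>
  Here \<open>G\<close> and \<open>g\<close> describe the even sets of size two, \<open>H\<close> and \<open>h\<close> the odd sets, and \<open>\<alpha>\<close>, \<open>\<beta>\<close> stand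
  for the values at the empty set and at \<open>I\<close>. The hypotheses \<open>H1\<close> and \<open>H2\<close> are exchange
  between a singleton and \<open>I\<close>, and between a triple and the empty set. If no pair \<open>X\<close> satisfied the
  conclusion, a weight \<open>p\<close> on the points with total \<open>\<alpha> - \<beta>\<close> would make \<open>g {x, y} + p x + p y\<close> exceed
  \<open>\<alpha>\<close> for every pair; by \<open>H1\<close> and \<open>H2\<close> no odd set could then minimize \<open>h X + sum p X\<close>.
\<close>

lemma four_point_lemma:
  fixes g h :: "'e set \<Rightarrow> real"
  assumes I: "I = {a, b, c, d}" and dist: "distinct [a, b, c, d]"
    and H1: "\<And>x. x \<in> I \<Longrightarrow> {x} \<in> H \<Longrightarrow> \<exists>j\<in>I - {x}. {x, j} \<in> G \<and> I - {j} \<in> H \<and>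
       g {x, j} + h (I - {j}) \<le> h {x} + \<beta>"
    and H2: "\<And>x. x \<in> I \<Longrightarrow> I - {x} \<in> H \<Longrightarrow> \<exists>j\<in>I - {x}. I - {x, j} \<in> G \<and> {j} \<in> H \<and>
       g (I - {x, j}) + h {j} \<le> h (I - {x}) + \<alpha>"
    and H3: "\<exists>x\<in>I. {x} \<in> H"
  shows "\<exists>X\<subseteq>I. card X = 2 \<and> X \<in> G \<and> I - X \<in> G \<and> g X + g (I - X) \<le> \<alpha> + \<beta>"
proof (rule ccontr)
  assume "\<not> ?thesis"
  then have fail: "g X + g (I - X) > \<alpha> + \<beta>" if "X \<subseteq> I" "card X = 2" "X \<in> G" "I - X \<in> G" for X
    using that by force
  have iv: "\<exists>r. (X \<in> G \<longrightarrow> r > \<alpha> - g X) \<and> (I - X \<in> G \<longrightarrow> r < g (I - X) - \<beta>)"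
    if "X \<subseteq> I" "card X = 2" for X
  proof (cases "X \<in> G \<and> I - X \<in> G")
    case True
    then have "\<alpha> - g X < g (I - X) - \<beta>" using fail[of X] that by auto
    then show ?thesis using dense by blast
  next
    case False then show ?thesis
      by (metis gt_ex lt_ex)
  qed
  have comp: "I - {a, b} = {c, d}" "I - {a, c} = {b, d}" "I - {a, d} = {b, c}"
    using dist by (auto simp: I)
  obtain r1 where r1: "{a, b} \<in> G \<longrightarrow> r1 > \<alpha> - g {a, b}" "{c, d} \<in> G \<longrightarrow> r1 < g {c, d} - \<beta>"
    using iv[of "{a, b}"] dist by (auto simp: comp) (auto simp: I)
  obtain r2 where r2: "{a, c} \<in> G \<longrightarrow> r2 > \<alpha> - g {a, c}" "{b, d} \<in> G \<longrightarrow> r2 < g {b, d} - \<beta>"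
    using iv[of "{a, c}"] dist by (auto simp: comp) (auto simp: I)
  obtain r3 where r3: "{a, d} \<in> G \<longrightarrow> r3 > \<alpha> - g {a, d}" "{b, c} \<in> G \<longrightarrow> r3 < g {b, c} - \<beta>"
    using iv[of "{a, d}"] dist by (auto simp: comp) (auto simp: I)
  \<comment> \<open>The values on the pairs through a are prescribed as r1, r2, r3, and the total as \<alpha> - \<beta>;
    those of the complementary pairs follow.\<close>
  define pa where "pa = (r1 + r2 + r3 - (\<alpha> - \<beta>)) / 2"
  define p where "p x = (if x = a then pa else if x = b then r1 - pa else if x = c then r2 - pa else r3 - pa)" for x
  have ne: "a \<noteq> b" "a \<noteq> c" "a \<noteq> d" "b \<noteq> c" "b \<noteq> d" "c \<noteq> d" "b \<noteq> a" "c \<noteq> a" "d \<noteq> a" "c \<noteq> b" "d \<noteq> b" "d \<noteq> c"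
    using dist by auto
  have p: "p a = pa" "p b = r1 - pa" "p c = r2 - pa" "p d = r3 - pa"
    using ne by (simp_all add: p_def)
  have tot: "sum p I = \<alpha> - \<beta>" using ne by (simp add: I p) (simp add: pa_def field_simps)
  have fI: "finite I" by (simp add: I)
  have pair: "g {x, y} + p x + p y > \<alpha>" if "x \<in> I" "y \<in> I" "x \<noteq> y" "{x, y} \<in> G" for x y
  proof -
    have "2 * pa = r1 + r2 + r3 - (\<alpha> - \<beta>)" by (simp add: pa_def)
    then show ?thesis using that r1 r2 r3 unfolding I by (auto simp: insert_commute p)
  qed
  define W where "W = H \<inter> ((\<lambda>x. {x}) ` I \<union> (\<lambda>x. I - {x}) ` I)"
  have "finite W" "W \<noteq> {}" using H3 by (auto simp: W_def I)
  then obtain X where X: "X \<in> W" and mn: "\<And>Y. Y \<in> W \<Longrightarrow> h X + sum p X \<le> h Y + sum p Y"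
    using ex_is_arg_min_if_finite[of W "\<lambda>X. h X + sum p X"] by (auto simp: is_arg_min_linorder)
  from X consider x where "x \<in> I" "X = {x}" "{x} \<in> H" | x where "x \<in> I" "X = I - {x}" "I - {x} \<in> H"
    by (auto simp: W_def)
  then show False
  proof cases
    case 1
    then obtain j where j: "j \<in> I - {x}" "{x, j} \<in> G" "I - {j} \<in> H"
       "g {x, j} + h (I - {j}) \<le> h {x} + \<beta>" using H1 by blast
    have "I - {j} \<in> W" using j by (auto simp: W_def)
    moreover have "sum p (I - {j}) = \<alpha> - \<beta> - p j" using j fI by (simp add: sum_diff1 tot)
    ultimately show False using mn[of "I - {j}"] pair[of x j] j 1 by auto
  next
    case 2
    then obtain j where j: "j \<in> I - {x}" "I - {x, j} \<in> G" "{j} \<in> H"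
       "g (I - {x, j}) + h {j} \<le> h (I - {x}) + \<alpha>" using H2 by blast
    have "{j} \<in> W" using j by (auto simp: W_def)
    moreover have "sum p (I - {x}) = \<alpha> - \<beta> - p x" using 2 fI by (simp add: sum_diff1 tot)
    moreover have "\<exists>y z. I - {x, j} = {y, z} \<and> y \<noteq> z \<and> y \<in> I \<and> z \<in> I"
      using j(1) 2(1) dist unfolding I by auto
    then obtain y z where yz: "I - {x, j} = {y, z}" "y \<noteq> z" "y \<in> I" "z \<in> I" by blast
    have "sum p (I - {x, j}) = \<alpha> - \<beta> - p x - p j"
      using j 2 fI by (auto simp: sum_diff tot)
    then have "p y + p z = \<alpha> - \<beta> - p x - p j" using yz by simp
    ultimately show False using mn[of "{j}"] pair[of y z] j 2 yz by auto
  qed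
qed

lemma exch_commute: "exch D f A B i j \<longleftrightarrow> exch D f A B j i"
  by (simp add: exch_def insert_commute)

lemma exchange_distance_2:
  assumes "card (A \<triangle> B) = 2" "A \<in> D" "B \<in> D" "i \<in> A \<triangle> B"
  shows "\<exists>j\<in>A \<triangle> B - {i}. exch D f A B i j"
proof -
  obtain j where j: "A \<triangle> B = {i, j}" "j \<noteq> i"
    using assms(1,4) by (metis card_2_iff insertE insert_commute singletonD)
  have "A \<triangle> {i, j} = B" "B \<triangle> {i, j} = A"
    unfolding j(1)[symmetric] by (auto simp: set_eq_iff)
  then show ?thesis using j assms by (auto simp: exch_def)
qed

text \<open>
  At distance 4 the choice of the flipped element is immaterial: flipping the complementary pair
  interchanges the roles of \<open>A\<close> and \<open>B\<close>.
\<close>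

lemma exchange_distance_4:
  assumes "card (A \<triangle> B) = 4" "k \<in> A \<triangle> B" "l \<in> A \<triangle> B" "k \<noteq> l" "exch D f A B k l" "i \<in> A \<triangle> B"
  shows "\<exists>j\<in>A \<triangle> B - {i}. exch D f A B i j"
proof (cases "i \<in> {k, l}")
  case True
  then show ?thesis using assms exch_commute[of D f A B] by blast
next
  case False
  have fin: "finite (A \<triangle> B)" using assms(1) by (metis card.infinite zero_neq_numeral)
  have "card (A \<triangle> B - {k, l, i}) = 1"
    using assms False fin by (subst card_Diff_subset) auto
  then obtain j where "A \<triangle> B - {k, l, i} = {j}" by (auto simp: card_1_singleton_iff)
  then have j: "A \<triangle> B = {k, l, i, j}" "j \<noteq> i" "j \<noteq> k" "j \<noteq> l" using assms by blast+
  have E: "(x \<in> A) \<noteq> (x \<in> B) \<longleftrightarrow> x = k \<or> x = l \<or> x = i \<or> x = j" for x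
    using j(1) mem_sd[of x A B] by auto
  have "A \<triangle> {i, j} = B \<triangle> {k, l}" "B \<triangle> {i, j} = A \<triangle> {k, l}"
    using E j False assms(4) by (auto simp: set_eq_iff)
  then have "exch D f A B i j" using assms(5) by (simp add: exch_def)
  then show ?thesis using j by blast
qed

text \<open>
  The induction step used below: for distance 4 some exchange is enough, for distance at
  least 6 only membership of one set has to be shown.
\<close>

lemma exchange_induct_step:
  fixes f :: "'e set \<Rightarrow> real"
  assumes fin: "finite (A \<triangle> B)" and ev: "even (card (A \<triangle> B))" and A: "A \<in> D" and B: "B \<in> D"
    and i: "i \<in> A \<triangle> B"
    and IH: "\<And>S T k. S \<in> D \<Longrightarrow> T \<in> D \<Longrightarrow> card (S \<triangle> T) < card (A \<triangle> B) \<Longrightarrow> k \<in> S \<triangle> T \<Longrightarrow>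
       \<exists>j\<in>S \<triangle> T - {k}. exch D f S T k j"
    and four: "card (A \<triangle> B) = 4 \<Longrightarrow> \<exists>k\<in>A \<triangle> B. \<exists>l\<in>A \<triangle> B - {k}. exch D f A B k l"
    and one: "card (A \<triangle> B) \<ge> 6 \<Longrightarrow> \<exists>j\<in>A \<triangle> B - {i}. A \<triangle> {i, j} \<in> D"
  shows "\<exists>j\<in>A \<triangle> B - {i}. exch D f A B i j"
proof -
  have "card (A \<triangle> B) \<noteq> 0" using i fin by auto
  then consider "card (A \<triangle> B) = 2" | "card (A \<triangle> B) = 4" | "card (A \<triangle> B) \<ge> 6"
  proof -
    obtain m where "card (A \<triangle> B) = 2 * m" using ev by (rule evenE)
    moreover have "m = 1 \<or> m = 2 \<or> m \<ge> 3" using calculation \<open>card (A \<triangle> B) \<noteq> 0\<close> by linarith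
    ultimately show thesis using that by auto
  qed
  then show ?thesis
  proof cases
    case 1 then show ?thesis using exchange_distance_2 A B i by metis
  next
    case 2
    then obtain k l where "k \<in> A \<triangle> B" "l \<in> A \<triangle> B - {k}" "exch D f A B k l" using four by blast
    then show ?thesis using exchange_distance_4[OF 2, of k l D f i] i by blast
  next
    case 3 then show ?thesis using exchange_step[OF fin 3 A B i IH one[OF 3]] by blast
  qed
qed

text \<open>
  At odd distance 3 a single flip always suffices, since flipping two elements of \<open>A \<triangle> B\<close> amounts
  to flipping the third and interchanging \<open>A\<close> and \<open>B\<close>.
\<close>

lemma exchange_distance_3:
  assumes ne: "natural_exchange D f" and A: "A \<in> D" "B \<in> D" and c3: "card (A \<triangle> B) = 3"
  shows "\<exists>k\<in>A \<triangle> B. A \<triangle> {k} \<in> D \<and> B \<triangle> {k} \<in> D \<and> f (A \<triangle> {k}) + f (B \<triangle> {k}) \<le> f A + f B"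
proof -
  obtain i p q where E: "A \<triangle> B = {i, p, q}" and d: "i \<noteq> p" "i \<noteq> q" "p \<noteq> q"
    using c3 by (metis card_3_iff)
  have ET: "(x \<in> A) \<noteq> (x \<in> B) \<longleftrightarrow> x = i \<or> x = p \<or> x = q" for x
    using E mem_sd[of x A B] by auto
  obtain j where j: "j \<in> A \<triangle> B" "exch D f A B i j"
    using ne A E unfolding natural_exchange_def by (metis insertI1)
  show ?thesis
  proof (cases "j = i")
    case True then show ?thesis using j by (auto simp: exch_def simp del: mem_sd)
  next
    case False
    define k where "k = (if j = p then q else p)"
    have "A \<triangle> {i, j} = B \<triangle> {k}" "B \<triangle> {i, j} = A \<triangle> {k}"
      using ET j(1) False d unfolding k_def E by (auto simp: set_eq_iff)
    moreover have "k \<in> A \<triangle> B" by (simp add: E k_def del: mem_sd)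
    ultimately show ?thesis using j(2) by (auto simp: exch_def simp del: mem_sd)
  qed
qed

section \<open>Completion to even sets\<close>

text \<open>
  Every member of \<open>D\<close> is completed to even size by the new element \<open>z\<close>, which belongs to no
  member of \<open>D\<close>. The accompanying function ignores \<open>z\<close>.
\<close>

definition evenize :: "'e \<Rightarrow> 'e set set \<Rightarrow> 'e set set" where
  "evenize z D = {A. finite A \<and> even (card A) \<and> A - {z} \<in> D}"

lemma evenize_local:
  fixes f :: "'e set \<Rightarrow> real"
  assumes ne: "natural_exchange D f" and z: "\<And>X. X \<in> D \<Longrightarrow> z \<notin> X"
    and A: "A \<in> evenize z D" and B: "B \<in> evenize z D" and c4: "card (A \<triangle> B) = 4"
  shows "\<exists>k\<in>A \<triangle> B. \<exists>l\<in>A \<triangle> B - {k}. exch (evenize z D) (\<lambda>X. f (X - {z})) A B k l"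
proof -
  define E where "E = A \<triangle> B"
  define A0 where "A0 = A - {z}"
  define B0 where "B0 = B - {z}"
  have AB0: "A0 \<in> D" "B0 \<in> D" using A B by (auto simp: evenize_def A0_def B0_def)
  have AB0E: "A0 \<triangle> B0 = E - {z}" by (auto simp: A0_def B0_def E_def set_eq_iff)
  have memI: "A \<triangle> X \<in> evenize z D" if "A \<in> evenize z D" "finite X" "even (card X)" "(A \<triangle> X) - {z} \<in> D" for A X
    using that even_card_sd[of A X] by (auto simp: evenize_def)
  have exI: "exch (evenize z D) (\<lambda>X. f (X - {z})) A B k l"
    if "k \<noteq> l" "(A \<triangle> {k, l}) - {z} \<in> D" "(B \<triangle> {k, l}) - {z} \<in> D"
      "f ((A \<triangle> {k, l}) - {z}) + f ((B \<triangle> {k, l}) - {z}) \<le> f A0 + f B0" for k l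
    using that memI[OF A, of "{k, l}"] memI[OF B, of "{k, l}"] unfolding exch_def A0_def B0_def by auto
  show ?thesis
  proof (cases "z \<in> E")
    case True
    have "card (A0 \<triangle> B0) = 3" using True c4 unfolding AB0E E_def by (simp del: mem_sd)
    then obtain k where k: "k \<in> E - {z}" "A0 \<triangle> {k} \<in> D" "B0 \<triangle> {k} \<in> D"
      "f (A0 \<triangle> {k}) + f (B0 \<triangle> {k}) \<le> f A0 + f B0"
      using exchange_distance_3[OF ne AB0] unfolding AB0E by blast
    have "(A \<triangle> {k, z}) - {z} = A0 \<triangle> {k}" "(B \<triangle> {k, z}) - {z} = B0 \<triangle> {k}"
      using k(1) by (auto simp: A0_def B0_def set_eq_iff)
    then have "exch (evenize z D) (\<lambda>X. f (X - {z})) A B k z"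
      using exI[of k z] k by simp
    then show ?thesis using k(1) True unfolding E_def by blast
  next
    case False
    have AB0E: "A0 \<triangle> B0 = E" using AB0E False by simp
    have zz: "(A \<triangle> X) - {z} = A0 \<triangle> X" "(B \<triangle> X) - {z} = B0 \<triangle> X" if "X \<subseteq> E" for X
      using that False unfolding A0_def B0_def by (auto simp: set_eq_iff)
    obtain i where i: "i \<in> E" using c4 unfolding E_def by (metis card.empty equals0I zero_neq_numeral)
    obtain j where j: "j \<in> E" "exch D f A0 B0 i j"
      using ne AB0 i unfolding natural_exchange_def AB0E[symmetric] by blast
    show ?thesis
    proof (cases "j = i")
      case False
      then have "exch (evenize z D) (\<lambda>X. f (X - {z})) A B i j"
        using j zz[of "{i, j}"] i exI[of i j] unfolding exch_def by auto
      then show ?thesis using i j False unfolding E_def by blast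
    next
      case True
      have single: "{i} \<in> {X. A0 \<triangle> X \<in> D}" using j(2) True by (simp add: exch_def)
      obtain p q r s where E: "E = {p, q, r, s}" and dist: "distinct [p, q, r, s]"
      proof -
        obtain xs where "set xs = E" "distinct xs" "length xs = 4"
          using c4 finite_distinct_list[of E] distinct_card unfolding E_def
          by (metis card.infinite zero_neq_numeral)
        then show ?thesis using that by (auto simp: numeral_eq_Suc length_Suc_conv)
      qed
      have fE: "finite E" by (simp add: E)
      have cE: "card (E - {x}) = 3" if "x \<in> E" for x using that c4 fE unfolding E_def by (simp del: mem_sd)
      have BE: "B0 = A0 \<triangle> E" unfolding AB0E[symmetric] by simp
      \<comment> \<open>All subsets of E, odd ones included, are evaluated by the same function here.\<close>
      have "\<exists>X\<subseteq>E. card X = 2 \<and> X \<in> {X. A0 \<triangle> X \<in> D} \<and> E - X \<in> {X. A0 \<triangle> X \<in> D} \<and>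
         f (A0 \<triangle> X) + f (A0 \<triangle> (E - X)) \<le> f A0 + f B0"
      proof (rule four_point_lemma[where H = "{X. A0 \<triangle> X \<in> D}" and h = "\<lambda>X. f (A0 \<triangle> X)", OF E dist])
        fix x assume x: "x \<in> E" "{x} \<in> {X. A0 \<triangle> X \<in> D}"
        have P: "A0 \<triangle> {x} \<triangle> B0 = E - {x}" using x unfolding BE by (auto simp: set_eq_iff)
        obtain k where k: "k \<in> E - {x}" "A0 \<triangle> {x} \<triangle> {k} \<in> D" "B0 \<triangle> {k} \<in> D"
          "f (A0 \<triangle> {x} \<triangle> {k}) + f (B0 \<triangle> {k}) \<le> f (A0 \<triangle> {x}) + f B0"
          using exchange_distance_3[OF ne, of "A0 \<triangle> {x}" B0] x AB0 cE unfolding P by auto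
        have *: "A0 \<triangle> {x} \<triangle> {k} = A0 \<triangle> {x, k}" "B0 \<triangle> {k} = A0 \<triangle> (E - {k})"
          using k(1) unfolding BE by (auto simp: set_eq_iff)
        show "\<exists>j\<in>E - {x}. {x, j} \<in> {X. A0 \<triangle> X \<in> D} \<and> E - {j} \<in> {X. A0 \<triangle> X \<in> D} \<and>
           f (A0 \<triangle> {x, j}) + f (A0 \<triangle> (E - {j})) \<le> f (A0 \<triangle> {x}) + f B0"
          using k unfolding * by blast
      next
        fix x assume x: "x \<in> E" "E - {x} \<in> {X. A0 \<triangle> X \<in> D}"
        have P: "A0 \<triangle> (E - {x}) \<triangle> A0 = E - {x}" by (auto simp: set_eq_iff)
        obtain k where k: "k \<in> E - {x}" "A0 \<triangle> (E - {x}) \<triangle> {k} \<in> D" "A0 \<triangle> {k} \<in> D"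
          "f (A0 \<triangle> (E - {x}) \<triangle> {k}) + f (A0 \<triangle> {k}) \<le> f (A0 \<triangle> (E - {x})) + f A0"
          using exchange_distance_3[OF ne, of "A0 \<triangle> (E - {x})" A0] x AB0 cE unfolding P by auto
        have *: "A0 \<triangle> (E - {x}) \<triangle> {k} = A0 \<triangle> (E - {x, k})"
          using k(1) by (auto simp: set_eq_iff)
        show "\<exists>j\<in>E - {x}. E - {x, j} \<in> {X. A0 \<triangle> X \<in> D} \<and> {j} \<in> {X. A0 \<triangle> X \<in> D} \<and>
           f (A0 \<triangle> (E - {x, j})) + f (A0 \<triangle> {j}) \<le> f (A0 \<triangle> (E - {x})) + f A0"
          using k unfolding * by blast
      next
        show "\<exists>x\<in>E. {x} \<in> {X. A0 \<triangle> X \<in> D}" using single i by blast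
      qed
      then obtain X where X: "X \<subseteq> E" "card X = 2" "A0 \<triangle> X \<in> D" "A0 \<triangle> (E - X) \<in> D"
        "f (A0 \<triangle> X) + f (A0 \<triangle> (E - X)) \<le> f A0 + f B0" by blast
      then obtain k l where kl: "X = {k, l}" "k \<noteq> l" by (auto simp: card_2_iff)
      have "A0 \<triangle> (E - X) = B0 \<triangle> X" using X(1) unfolding BE by (auto simp: set_eq_iff)
      then have "exch (evenize z D) (\<lambda>X. f (X - {z})) A B k l"
        using exI[of k l] kl zz[of X] X by auto
      then show ?thesis using kl X(1) unfolding E_def by blast
    qed
  qed
qed

text \<open>
  Induction on the distance. Among pairs of equal distance, those with \<open>z \<in> A \<triangle> B\<close> come first:
  the required member \<open>A \<triangle> {i, j}\<close> then requires closer pairs at most, while the case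
  \<open>z \<notin> A \<triangle> B\<close> may need a pair of the same distance whose symmetric difference contains \<open>z\<close>.
\<close>

theorem even_exchange_evenize:
  fixes f :: "'e set \<Rightarrow> real"
  assumes ne: "natural_exchange D f" and z: "\<And>X. X \<in> D \<Longrightarrow> z \<notin> X"
  shows "even_exchange (evenize z D) (\<lambda>X. f (X - {z}))"
proof -
  let ?D = "evenize z D" and ?f = "\<lambda>X. f (X - {z})"
  have fin: "finite A" if "A \<in> ?D" for A using that by (simp add: evenize_def)
  have ev: "even (card (A \<triangle> B))" if "A \<in> ?D" "B \<in> ?D" for A B
    using that even_card_sd[of A B] by (simp add: evenize_def)
  have memI: "A \<triangle> {k, l} \<in> ?D" if "A \<in> ?D" "k \<noteq> l" "(A \<triangle> {k, l}) - {z} \<in> D" for A k l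
    using that even_card_sd[of A "{k, l}"] by (auto simp: evenize_def)
  have nx: "\<exists>g\<in>A \<triangle> B - {z}. (A - {z}) \<triangle> {i, g} \<in> D \<and> (B - {z}) \<triangle> {i, g} \<in> D"
    if "A \<in> ?D" "B \<in> ?D" "i \<in> A \<triangle> B - {z}" for A B i
  proof -
    have "(A - {z}) \<triangle> (B - {z}) = A \<triangle> B - {z}" by (auto simp: set_eq_iff)
    then show ?thesis using ne that unfolding natural_exchange_def evenize_def exch_def
      by (metis (no_types, lifting) mem_Collect_eq)
  qed
  have mem1: "A \<triangle> {i, g} \<in> ?D"
    if "A \<in> ?D" "(A - {z}) \<triangle> {i, g} \<in> D" "i \<noteq> z" "g \<noteq> z" "g \<noteq> i" for A i g
  proof -
    have "(A \<triangle> {i, g}) - {z} = (A - {z}) \<triangle> {i, g}" using that by (auto simp: set_eq_iff)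
    then show ?thesis using memI[of A i g] that by auto
  qed
  have mem2: "A \<triangle> {i, z} \<in> ?D" if "A \<in> ?D" "(A - {z}) \<triangle> {i, i} \<in> D" "i \<noteq> z" for A i
  proof -
    have "(A \<triangle> {i, z}) - {z} = (A - {z}) \<triangle> {i, i}" using that by (auto simp: set_eq_iff)
    then show ?thesis using memI[of A i z] that by auto
  qed
  have "\<exists>j\<in>A \<triangle> B - {i}. exch ?D ?f A B i j" if "A \<in> ?D" "B \<in> ?D" "i \<in> A \<triangle> B" for A B i
    using that
  proof (induction "card (A \<triangle> B)" arbitrary: A B i rule: less_induct)
    case less
    define n where "n = card (A \<triangle> B)"
    have IH: "\<exists>j\<in>S \<triangle> T - {k}. exch ?D ?f S T k j"
      if "S \<in> ?D" "T \<in> ?D" "card (S \<triangle> T) < n" "k \<in> S \<triangle> T" for S T k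
      using less.hyps that unfolding n_def by blast
    have with_z: "\<exists>j\<in>A \<triangle> B - {i}. exch ?D ?f A B i j"
      if A: "A \<in> ?D" and B: "B \<in> ?D" and i: "i \<in> A \<triangle> B" and c: "card (A \<triangle> B) = n" and zAB: "z \<in> A \<triangle> B" for A B i
    proof (rule exchange_induct_step)
      assume c6: "card (A \<triangle> B) \<ge> 6"
      show "\<exists>j\<in>A \<triangle> B - {i}. A \<triangle> {i, j} \<in> ?D"
      proof (cases "i = z")
        case False
        then obtain g where g: "g \<in> A \<triangle> B - {z}" "(A - {z}) \<triangle> {i, g} \<in> D" using nx[OF A B] i by blast
        show ?thesis
        proof (cases "g = i")
          case True
          then have "A \<triangle> {i, z} \<in> ?D" using mem2 A g False by blast
          then show ?thesis using zAB False by blast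
        next
          case False': False
          then have "A \<triangle> {i, g} \<in> ?D" using mem1 A g False by blast
          then show ?thesis using g False' by blast
        qed
      next
        case True
        have "A \<triangle> B - {z} \<noteq> {}"
        proof
          assume "A \<triangle> B - {z} = {}"
          then have "A \<triangle> B \<subseteq> {z}" by blast
          then have "card (A \<triangle> B) \<le> 1" using card_mono[of "{z}"] by fastforce
          then show False using c6 by simp
        qed
        then obtain e where e: "e \<in> A \<triangle> B - {z}" by blast
        then obtain g where g: "g \<in> A \<triangle> B - {z}" "(A - {z}) \<triangle> {e, g} \<in> D" "(B - {z}) \<triangle> {e, g} \<in> D"
          using nx[OF A B] by blast
        show ?thesis
        proof (cases "g = e")
          case True
          then have "A \<triangle> {z, e} \<in> ?D" using mem2 A g e by (metis Diff_iff insertCI insert_commute)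
          then show ?thesis using e \<open>i = z\<close> by blast
        next
          case False
          \<comment> \<open>Two flips only: exchange at z between A and the closer set B with e and g flipped.\<close>
          then have B': "B \<triangle> {e, g} \<in> ?D" using mem1 B g e by blast
          have AB': "A \<triangle> (B \<triangle> {e, g}) = A \<triangle> B - {e, g}" using e g(1) by (auto simp: set_eq_iff)
          have "card (A \<triangle> B - {e, g}) < n"
          proof -
            have "A \<triangle> B - {e, g} \<subset> A \<triangle> B" using e by blast
            then show ?thesis unfolding c[symmetric]
              by (rule psubset_card_mono[OF finite_sd[OF fin[OF A] fin[OF B]]])
          qed
          then obtain j where "j \<in> A \<triangle> B - {e, g} - {z}" "exch ?D ?f A (B \<triangle> {e, g}) z j"
            using IH[OF A B', of z] zAB e g unfolding AB' by blast
          then show ?thesis using \<open>i = z\<close> by (auto simp: exch_def simp del: mem_sd)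
        qed
      qed
    next
      assume "card (A \<triangle> B) = 4"
      then show "\<exists>k\<in>A \<triangle> B. \<exists>l\<in>A \<triangle> B - {k}. exch ?D ?f A B k l"
        using evenize_local[OF ne z A B] by blast
    next
      show "finite (A \<triangle> B)" using fin A B by simp
    qed (use IH ev A B i c in \<open>auto simp del: mem_sd\<close>)
    show ?case
    proof (cases "z \<in> A \<triangle> B")
      case True then show ?thesis using with_z less.prems n_def by blast
    next
      case zAB: False
      show ?thesis
      proof (rule exchange_induct_step)
        have "i \<noteq> z" using zAB less.prems by blast
        then obtain g where g: "g \<in> A \<triangle> B - {z}" "(A - {z}) \<triangle> {i, g} \<in> D"
          using nx[OF less.prems(1,2)] less.prems(3) by blast
        show "\<exists>j\<in>A \<triangle> B - {i}. A \<triangle> {i, j} \<in> ?D"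
        proof (cases "g = i")
          case False
          then have "A \<triangle> {i, g} \<in> ?D" using mem1 less.prems g \<open>i \<noteq> z\<close> by blast
          then show ?thesis using g False by blast
        next
          case True
          then have A': "A \<triangle> {i, z} \<in> ?D" using mem2 less.prems g \<open>i \<noteq> z\<close> by blast
          \<comment> \<open>A single flip of i in the original family: exchange at z between A with i, z flipped and B
            replaces z by the element sought.\<close>
          have AB': "A \<triangle> {i, z} \<triangle> B = insert z (A \<triangle> B - {i})"
            using less.prems(3) zAB by (auto simp: set_eq_iff)
          have "finite (A \<triangle> B)" using fin less.prems by simp
          then have "card (A \<triangle> {i, z} \<triangle> B) = Suc (card (A \<triangle> B - {i}))"
            unfolding AB' using zAB by simp
          also have "\<dots> = n"
            unfolding n_def using \<open>finite (A \<triangle> B)\<close> less.prems(3) by (rule card_Suc_Diff1)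
          finally have "card (A \<triangle> {i, z} \<triangle> B) = n" .
          then obtain j where j: "j \<in> A \<triangle> B - {i}" "exch ?D ?f (A \<triangle> {i, z}) B z j"
            using with_z[OF A' less.prems(2), of z] unfolding AB' by blast
          have "A \<triangle> {i, z} \<triangle> {z, j} = A \<triangle> {i, j}"
            using j(1) \<open>i \<noteq> z\<close> zAB by (auto simp: set_eq_iff)
          then show ?thesis using j by (auto simp: exch_def simp del: mem_sd)
        qed
      next
        assume "card (A \<triangle> B) = 4"
        then show "\<exists>k\<in>A \<triangle> B. \<exists>l\<in>A \<triangle> B - {k}. exch ?D ?f A B k l"
          using evenize_local[OF ne z less.prems(1,2)] by blast
      next
        show "finite (A \<triangle> B)" using fin less.prems by simp
      qed (use IH ev less.prems n_def in \<open>auto simp del: mem_sd\<close>)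
    qed
  qed
  then show ?thesis using fin ev unfolding even_exchange_def by blast
qed

section \<open>Projecting away cancelling pairs\<close>

text \<open>
  Projecting away \<open>a\<close> and \<open>b\<close>: a set avoiding both belongs to the new family if it belongs
  to \<open>D\<close> either as it is or with both \<open>a\<close> and \<open>b\<close> added.
\<close>

definition contract :: "'e \<Rightarrow> 'e \<Rightarrow> 'e set set \<Rightarrow> 'e set set" where
  "contract a b D = {S. a \<notin> S \<and> b \<notin> S \<and> (S \<in> D \<or> S \<triangle> {a, b} \<in> D)}"

text \<open>
  The smaller of the two values, where sets outside \<open>D\<close> count as having value infinity.
\<close>

definition contract_fun :: "'e \<Rightarrow> 'e \<Rightarrow> 'e set set \<Rightarrow> ('e set \<Rightarrow> real) \<Rightarrow> 'e set \<Rightarrow> real" where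
  "contract_fun a b D f S =
     (if S \<in> D \<and> (S \<triangle> {a, b} \<in> D \<longrightarrow> f S \<le> f (S \<triangle> {a, b})) then f S else f (S \<triangle> {a, b}))"

lemma contract_rep:
  assumes "S \<in> contract a b D"
  obtains R where "R = S \<or> R = S \<triangle> {a, b}" "R \<in> D" "f R = contract_fun a b D f S"
proof (cases "S \<in> D \<and> (S \<triangle> {a, b} \<in> D \<longrightarrow> f S \<le> f (S \<triangle> {a, b}))")
  case True
  then show thesis using that[of S] unfolding contract_fun_def by presburger
next
  case False
  then have "S \<triangle> {a, b} \<in> D" using assms unfolding contract_def by blast
  then show thesis using that[of "S \<triangle> {a, b}"] False unfolding contract_fun_def by presburger
qed

lemma contract_memI:
  assumes "R = S \<or> R = S \<triangle> {a, b}" "R \<in> D" "a \<notin> S" "b \<notin> S"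
  shows "S \<in> contract a b D"
  using assms unfolding contract_def by blast

lemma contract_fun_le:
  assumes "R = S \<or> R = S \<triangle> {a, b}" "R \<in> D"
  shows "contract_fun a b D f S \<le> f R"
  using assms(1)
proof
  assume R: "R = S"
  then have "S \<in> D" using assms(2) by simp
  show ?thesis
  proof (cases "S \<triangle> {a, b} \<in> D \<longrightarrow> f S \<le> f (S \<triangle> {a, b})")
    case True
    then have "contract_fun a b D f S = f S" using \<open>S \<in> D\<close> unfolding contract_fun_def by presburger
    then show ?thesis using R by simp
  next
    case False
    then have "contract_fun a b D f S = f (S \<triangle> {a, b})" unfolding contract_fun_def by presburger
    moreover have "f (S \<triangle> {a, b}) \<le> f S" using False by linarith
    ultimately show ?thesis using R by simp
  qed
next
  assume R: "R = S \<triangle> {a, b}"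
  show ?thesis
  proof (cases "S \<in> D \<and> (S \<triangle> {a, b} \<in> D \<longrightarrow> f S \<le> f (S \<triangle> {a, b}))")
    case True
    then have "contract_fun a b D f S = f S" unfolding contract_fun_def by presburger
    then show ?thesis using R True assms(2) by simp
  next
    case False
    then have "contract_fun a b D f S = f (S \<triangle> {a, b})" unfolding contract_fun_def by (rule if_not_P)
    then show ?thesis using R by simp
  qed
qed

lemma contract_commute: "contract a b D = contract b a D" "contract_fun a b D f = contract_fun b a D f"
proof -
  have ab: "{a, b} = {b, a}" by blast
  show "contract a b D = contract b a D" unfolding contract_def ab by blast
  show "contract_fun a b D f = contract_fun b a D f" unfolding contract_fun_def fun_eq_iff ab by blast
qed

lemma contract_exch:
  assumes RA: "RA = A \<or> RA = A \<triangle> {a, b}" and RB: "RB = B \<or> RB = B \<triangle> {a, b}"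
    and ab: "a \<notin> A" "b \<notin> A" "a \<notin> B" "b \<notin> B" "i \<notin> {a, b}" "j \<notin> {a, b}"
    and ex: "exch D f RA RB i j"
    and vals: "f RA = contract_fun a b D f A" "f RB = contract_fun a b D f B"
  shows "exch (contract a b D) (contract_fun a b D f) A B i j"
proof -
  have 1: "RA \<triangle> {i, j} = A \<triangle> {i, j} \<or> RA \<triangle> {i, j} = A \<triangle> {i, j} \<triangle> {a, b}"
    "RB \<triangle> {i, j} = B \<triangle> {i, j} \<or> RB \<triangle> {i, j} = B \<triangle> {i, j} \<triangle> {a, b}"
    using RA RB by (metis sd_assoc sd_commute)+
  have 2: "a \<notin> A \<triangle> {i, j}" "b \<notin> A \<triangle> {i, j}" "a \<notin> B \<triangle> {i, j}" "b \<notin> B \<triangle> {i, j}"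
    using ab by auto
  have 3: "RA \<triangle> {i, j} \<in> D" "RB \<triangle> {i, j} \<in> D" "f (RA \<triangle> {i, j}) + f (RB \<triangle> {i, j}) \<le> f RA + f RB"
    using ex by (auto simp: exch_def)
  show ?thesis
    unfolding exch_def
    using contract_memI[OF 1(1) 3(1) 2(1,2)] contract_memI[OF 1(2) 3(2) 2(3,4)]
      contract_fun_le[OF 1(1) 3(1), of f] contract_fun_le[OF 1(2) 3(2), of f] 3(3) vals
    by auto
qed

text \<open>
  Distance 4, when the optimal members \<open>RA\<close> and \<open>RB\<close> over \<open>A\<close> and \<open>B\<close> also differ in \<open>a\<close> and \<open>b\<close>.
  The odd sets of \<open>four_point_lemma\<close> are those obtained from \<open>RA\<close> by flipping \<open>a\<close> and not \<open>b\<close>;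
  exchange of such a set with \<open>RB\<close> at \<open>b\<close>, or with \<open>RA\<close> at \<open>a\<close>, turns it into a set over an even
  subset, and \<open>RB\<close> or \<open>RA\<close> into a set of the kind described.
\<close>

lemma contract_local:
  fixes f :: "'e set \<Rightarrow> real"
  assumes vdm: "even_exchange D f" and ab: "a \<noteq> b"
    and A: "a \<notin> A" "b \<notin> A" and B: "a \<notin> B" "b \<notin> B"
    and RA: "RA = A \<or> RA = A \<triangle> {a, b}" "RA \<in> D" "f RA = contract_fun a b D f A"
    and RB: "RB \<in> D" "f RB = contract_fun a b D f B"
    and RAB: "RA \<triangle> RB = A \<triangle> B \<triangle> {a, b}"
    and c4: "card (A \<triangle> B) = 4"
    and i: "i \<in> A \<triangle> B" "RA \<triangle> {i, a} \<in> D"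
  shows "\<exists>k\<in>A \<triangle> B. \<exists>l\<in>A \<triangle> B - {k}. exch (contract a b D) (contract_fun a b D f) A B k l"
proof -
  define E where "E = A \<triangle> B"
  have abE: "a \<notin> E" "b \<notin> E" using A B by (auto simp: E_def)
  obtain p q r s where E: "E = {p, q, r, s}" and dist: "distinct [p, q, r, s]"
  proof -
    obtain xs where "set xs = E" "distinct xs" "length xs = 4"
      using c4 finite_distinct_list[of E] distinct_card unfolding E_def
      by (metis card.infinite zero_neq_numeral)
    then show ?thesis using that by (auto simp: numeral_eq_Suc length_Suc_conv)
  qed
  have RBe: "RB = RA \<triangle> E \<triangle> {a, b}"
    using RAB unfolding E_def by (metis sd_assoc sd_self(2))
  have ex: "\<exists>j\<in>S \<triangle> T - {k}. exch D f S T k j" if "S \<in> D" "T \<in> D" "k \<in> S \<triangle> T" for S T k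
    using vdm that unfolding even_exchange_def by blast
  have "\<exists>X\<subseteq>E. card X = 2 \<and> X \<in> {X. A \<triangle> X \<in> contract a b D} \<and> E - X \<in> {X. A \<triangle> X \<in> contract a b D} \<and>
     contract_fun a b D f (A \<triangle> X) + contract_fun a b D f (A \<triangle> (E - X)) \<le> f RA + f RB"
  proof (rule four_point_lemma[where H = "{X. RA \<triangle> X \<triangle> {a} \<in> D}" and h = "\<lambda>X. f (RA \<triangle> X \<triangle> {a})", OF E dist])
    fix x assume x: "x \<in> E" "{x} \<in> {X. RA \<triangle> X \<triangle> {a} \<in> D}"
    define P where "P = RA \<triangle> {x} \<triangle> {a}"
    have PR: "P \<triangle> RB = (E - {x}) \<union> {b}" using abE x ab unfolding P_def RBe by (auto simp: set_eq_iff)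
    then obtain j where j: "j \<in> E - {x}" "exch D f P RB b j"
      using ex[of P RB b] x RB(1) unfolding P_def by auto
    have *: "P \<triangle> {b, j} = A \<triangle> {x, j} \<or> P \<triangle> {b, j} = A \<triangle> {x, j} \<triangle> {a, b}" "RB \<triangle> {b, j} = RA \<triangle> (E - {j}) \<triangle> {a}"
    proof -
      have "P \<triangle> {b, j} = RA \<triangle> {x, j} \<triangle> {a, b}" using j x abE ab unfolding P_def by (auto simp: set_eq_iff)
      moreover have "A \<triangle> {a, b} \<triangle> {x, j} \<triangle> {a, b} = A \<triangle> {x, j}" by (auto simp: set_eq_iff)
      ultimately show "P \<triangle> {b, j} = A \<triangle> {x, j} \<or> P \<triangle> {b, j} = A \<triangle> {x, j} \<triangle> {a, b}" using RA(1) by metis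
      show "RB \<triangle> {b, j} = RA \<triangle> (E - {j}) \<triangle> {a}"
        using j x abE ab unfolding RBe by (auto simp: set_eq_iff)
    qed
    have na: "a \<notin> A \<triangle> {x, j}" "b \<notin> A \<triangle> {x, j}" using A j x abE by auto
    have e: "P \<triangle> {b, j} \<in> D" "RB \<triangle> {b, j} \<in> D" "f (P \<triangle> {b, j}) + f (RB \<triangle> {b, j}) \<le> f P + f RB"
      using j(2) by (auto simp: exch_def)
    show "\<exists>j\<in>E - {x}. {x, j} \<in> {X. A \<triangle> X \<in> contract a b D} \<and> E - {j} \<in> {X. RA \<triangle> X \<triangle> {a} \<in> D} \<and>
        contract_fun a b D f (A \<triangle> {x, j}) + f (RA \<triangle> (E - {j}) \<triangle> {a}) \<le> f (RA \<triangle> {x} \<triangle> {a}) + f RB"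
      using contract_memI[OF *(1) e(1) na] contract_fun_le[OF *(1) e(1), of f] e j(1) unfolding *(2) P_def
      by (intro bexI[of _ j]) auto
  next
    fix x assume x: "x \<in> E" "E - {x} \<in> {X. RA \<triangle> X \<triangle> {a} \<in> D}"
    define P where "P = RA \<triangle> (E - {x}) \<triangle> {a}"
    have PR: "P \<triangle> RA = (E - {x}) \<union> {a}" using abE x ab unfolding P_def by (auto simp: set_eq_iff)
    then obtain j where j: "j \<in> E - {x}" "exch D f P RA a j"
      using ex[of P RA a] x RA(2) unfolding P_def by auto
    have *: "P \<triangle> {a, j} = A \<triangle> (E - {x, j}) \<or> P \<triangle> {a, j} = A \<triangle> (E - {x, j}) \<triangle> {a, b}" "RA \<triangle> {a, j} = RA \<triangle> {j} \<triangle> {a}"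
    proof -
      have "P \<triangle> {a, j} = RA \<triangle> (E - {x, j})" using j x abE ab unfolding P_def by (auto simp: set_eq_iff)
      moreover have "A \<triangle> {a, b} \<triangle> (E - {x, j}) = A \<triangle> (E - {x, j}) \<triangle> {a, b}" by (auto simp: set_eq_iff)
      ultimately show "P \<triangle> {a, j} = A \<triangle> (E - {x, j}) \<or> P \<triangle> {a, j} = A \<triangle> (E - {x, j}) \<triangle> {a, b}" using RA(1) by metis
      show "RA \<triangle> {a, j} = RA \<triangle> {j} \<triangle> {a}"
        using j x abE ab by (auto simp: set_eq_iff)
    qed
    have na: "a \<notin> A \<triangle> (E - {x, j})" "b \<notin> A \<triangle> (E - {x, j})" using A j x abE by auto
    have e: "P \<triangle> {a, j} \<in> D" "RA \<triangle> {a, j} \<in> D" "f (P \<triangle> {a, j}) + f (RA \<triangle> {a, j}) \<le> f P + f RA"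
      using j(2) by (auto simp: exch_def)
    show "\<exists>j\<in>E - {x}. E - {x, j} \<in> {X. A \<triangle> X \<in> contract a b D} \<and> {j} \<in> {X. RA \<triangle> X \<triangle> {a} \<in> D} \<and>
        contract_fun a b D f (A \<triangle> (E - {x, j})) + f (RA \<triangle> {j} \<triangle> {a}) \<le> f (RA \<triangle> (E - {x}) \<triangle> {a}) + f RA"
      using contract_memI[OF *(1) e(1) na] contract_fun_le[OF *(1) e(1), of f] e j(1) unfolding *(2) P_def
      by (intro bexI[of _ j]) auto
  next
    have "RA \<triangle> {i, a} = RA \<triangle> {i} \<triangle> {a}" using i abE unfolding E_def by (auto simp: set_eq_iff)
    then show "\<exists>x\<in>E. {x} \<in> {X. RA \<triangle> X \<triangle> {a} \<in> D}" using i unfolding E_def by auto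
  qed
  then obtain X where X: "X \<subseteq> E" "card X = 2" "A \<triangle> X \<in> contract a b D" "A \<triangle> (E - X) \<in> contract a b D"
     "contract_fun a b D f (A \<triangle> X) + contract_fun a b D f (A \<triangle> (E - X)) \<le> f RA + f RB" by blast
  then obtain k l where kl: "X = {k, l}" "k \<noteq> l" by (auto simp: card_2_iff)
  have "A \<triangle> (E - X) = B \<triangle> X" using X(1) unfolding E_def by (auto simp: set_eq_iff)
  then have "exch (contract a b D) (contract_fun a b D f) A B k l"
    using X RA(3) RB(2) unfolding kl(1) exch_def by auto
  then show ?thesis using kl X(1) unfolding E_def by blast
qed

text \<open>
  If the exchange partner of \<open>i\<close> is \<open>a\<close> (or likewise \<open>b\<close>), a second exchange at \<open>b\<close> towards \<open>RB\<close> ends in a set that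
  contains both or none of \<open>a\<close>, \<open>b\<close>, and the symmetric difference has become smaller, so
  neither \<open>i\<close> nor \<open>a\<close> is flipped back.
\<close>

lemma contract_one_sided:
  fixes f :: "'e set \<Rightarrow> real"
  assumes vdm: "even_exchange D f" and ab: "a \<noteq> b"
    and A: "A \<in> contract a b D" and B: "B \<in> contract a b D" and i: "i \<in> A \<triangle> B"
  shows "\<exists>j\<in>A \<triangle> B - {i}. A \<triangle> {i, j} \<in> contract a b D"
proof -
  have nab: "a \<notin> A" "b \<notin> A" "a \<notin> B" "b \<notin> B" using A B by (auto simp: contract_def)
  obtain RA where RA: "RA = A \<or> RA = A \<triangle> {a, b}" "RA \<in> D" using contract_rep[OF A] by metis
  obtain RB where RB: "RB = B \<or> RB = B \<triangle> {a, b}" "RB \<in> D" using contract_rep[OF B] by metis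
  have ex: "\<exists>j\<in>S \<triangle> T - {k}. S \<triangle> {k, j} \<in> D" if "S \<in> D" "T \<in> D" "k \<in> S \<triangle> T" for S T k
    using vdm that unfolding even_exchange_def exch_def by blast
  have iab: "i \<noteq> a" "i \<noteq> b" using i nab by auto
  have good: ?thesis if "j \<in> A \<triangle> B - {i}" "R \<in> D" "R = A \<triangle> {i, j} \<or> R = A \<triangle> {i, j} \<triangle> {a, b}" for j R
  proof -
    have "a \<notin> A \<triangle> {i, j}" "b \<notin> A \<triangle> {i, j}" using that(1) nab iab by auto
    then show ?thesis using contract_memI[OF that(3,2)] that(1) by blast
  qed
  have good2: ?thesis if ab': "{a', b'} = {a, b}" "a' \<noteq> b'" and a': "a' \<in> RA \<triangle> RB" and R1: "RA \<triangle> {i, a'} \<in> D" for a' b'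
  proof -
    have nab': "a' \<notin> A" "b' \<notin> A" "a' \<notin> B" "b' \<notin> B" "i \<noteq> a'" "i \<noteq> b'" "b' \<noteq> a'"
      using nab iab ab' by (auto simp: doubleton_eq_iff)
    have RAB: "RA \<triangle> RB = A \<triangle> B \<triangle> {a', b'}"
      using RA(1) RB(1) a' nab' unfolding ab'(1)[symmetric] by (auto simp: set_eq_iff)
    have E: "RA \<triangle> {i, a'} \<triangle> RB = (A \<triangle> B - {i}) \<union> {b'}"
    proof -
      have "RA \<triangle> {i, a'} \<triangle> RB = RA \<triangle> RB \<triangle> {i, a'}" by (auto simp: set_eq_iff)
      also have "\<dots> = (A \<triangle> B - {i}) \<union> {b'}"
        unfolding RAB using nab' i by (auto simp: set_eq_iff)
      finally show ?thesis .
    qed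
    then obtain k where k: "k \<in> A \<triangle> B - {i}" "RA \<triangle> {i, a'} \<triangle> {b', k} \<in> D"
      using ex[OF R1 RB(2), of b'] nab' unfolding E by blast
    have "RA \<triangle> {i, a'} \<triangle> {b', k} = RA \<triangle> {i, k} \<triangle> {a, b}"
      unfolding ab'(1)[symmetric] using k(1) nab' by (auto simp: set_eq_iff)
    moreover have "A \<triangle> {a, b} \<triangle> {i, k} \<triangle> {a, b} = A \<triangle> {i, k}" by (auto simp: set_eq_iff)
    ultimately show ?thesis using good[OF k] RA(1) by metis
  qed
  have "i \<in> RA \<triangle> RB" using i RA RB iab by auto
  then obtain j where j: "j \<in> RA \<triangle> RB - {i}" "RA \<triangle> {i, j} \<in> D" using ex RA RB by blast
  consider "j = a" | "j = b" | "j \<noteq> a" "j \<noteq> b" by blast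
  then show ?thesis
  proof cases
    case 1 then show ?thesis using good2[of a b] j ab by auto
  next
    case 2 then show ?thesis using good2[of b a] j ab by auto
  next
    case 3
    then have "j \<in> A \<triangle> B - {i}" using j(1) RA(1) RB(1) by auto
    moreover have "RA \<triangle> {i, j} = A \<triangle> {i, j} \<or> RA \<triangle> {i, j} = A \<triangle> {i, j} \<triangle> {a, b}"
      using RA(1) by (metis sd_assoc sd_commute)
    ultimately show ?thesis using good j(2) by blast
  qed
qed

theorem even_exchange_contract:
  fixes f :: "'e set \<Rightarrow> real"
  assumes vdm: "even_exchange D f" and ab: "a \<noteq> b"
  shows "even_exchange (contract a b D) (contract_fun a b D f)"
proof -
  let ?C = "contract a b D" and ?g = "contract_fun a b D f"
  have finD: "finite A" if "A \<in> D" for A using vdm that by (auto simp: even_exchange_def)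
  have fin: "finite A" if A: "A \<in> ?C" for A
  proof -
    obtain R where R: "R = A \<or> R = A \<triangle> {a, b}" "R \<in> D" using contract_rep[OF A] by metis
    have "A = R \<or> A = R \<triangle> {a, b}" using R(1) by (auto simp: sd_assoc)
    then show ?thesis using finD[OF R(2)] by auto
  qed
  have parD: "even (card A) \<longleftrightarrow> even (card B)" if "A \<in> D" "B \<in> D" for A B
    using vdm that even_card_sd[of A B] finD by (auto simp: even_exchange_def)
  have par: "\<exists>R\<in>D. even (card R) \<longleftrightarrow> even (card A)" if A: "A \<in> ?C" for A
  proof -
    obtain R where R: "R = A \<or> R = A \<triangle> {a, b}" "R \<in> D" using contract_rep[OF A] by metis
    have "card {a, b} = 2" using ab by simp
    then show ?thesis using R even_card_sd[OF fin[OF A], of "{a, b}"] by auto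
  qed
  have ev: "even (card (A \<triangle> B))" if "A \<in> ?C" "B \<in> ?C" for A B
    using par[OF that(1)] par[OF that(2)] parD even_card_sd[OF fin fin, OF that] by metis
  have "\<exists>j\<in>A \<triangle> B - {i}. exch ?C ?g A B i j" if "A \<in> ?C" "B \<in> ?C" "i \<in> A \<triangle> B" for A B i
    using that
  proof (induction "card (A \<triangle> B)" arbitrary: A B i rule: less_induct)
    case less
    have nab: "a \<notin> A" "b \<notin> A" "a \<notin> B" "b \<notin> B" using less.prems by (auto simp: contract_def)
    show ?case
    proof (rule exchange_induct_step)
      assume c4: "card (A \<triangle> B) = 4"
      obtain RA where RA: "RA = A \<or> RA = A \<triangle> {a, b}" "RA \<in> D" "f RA = ?g A"
        using contract_rep[OF less.prems(1)] by metis
      obtain RB where RB: "RB = B \<or> RB = B \<triangle> {a, b}" "RB \<in> D" "f RB = ?g B"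
        using contract_rep[OF less.prems(2)] by metis
      have iab: "i \<notin> {a, b}" using less.prems(3) nab by auto
      have "i \<in> RA \<triangle> RB" using less.prems(3) RA(1) RB(1) iab by auto
      then obtain j where j: "j \<in> RA \<triangle> RB - {i}" "exch D f RA RB i j"
        using vdm RA(2) RB(2) unfolding even_exchange_def by blast
      show "\<exists>k\<in>A \<triangle> B. \<exists>l\<in>A \<triangle> B - {k}. exch ?C ?g A B k l"
      proof (cases "j \<in> {a, b}")
        case False
        then have "j \<in> A \<triangle> B - {i}" using j(1) RA(1) RB(1) by auto
        then show ?thesis
          using contract_exch[OF RA(1) RB(1) nab iab False j(2) RA(3) RB(3)] less.prems(3) by blast
      next
        case True
        have RAB: "RA \<triangle> RB = A \<triangle> B \<triangle> {a, b}"
          using RA(1) RB(1) j(1) True nab by (auto simp: set_eq_iff)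
        have ja: "RA \<triangle> {i, j} \<in> D" using j(2) by (simp add: exch_def)
        show ?thesis
        proof (cases "j = a")
          case True
          then show ?thesis
            using contract_local[OF vdm ab nab RA RB(2,3) RAB c4 less.prems(3)] ja by simp
        next
          case False
          then have "j = b" using True by simp
          then show ?thesis
            using contract_local[OF vdm ab[symmetric] nab(2,1,4,3), of RA RB i]
              RA RB RAB c4 less.prems(3) ja
            unfolding contract_commute[of b a] insert_commute[of b a] by blast
        qed
      qed
    qed (use less ev fin contract_one_sided[OF vdm ab] in \<open>auto simp del: mem_sd\<close>)
  qed
  then show ?thesis using fin ev unfolding even_exchange_def by blast
qed

text \<open>
  Exchange modulo cancellation: \<open>E'\<close> is what remains of \<open>E\<close> when pairs of elements other than \<open>i\<close> with opposite
  weights have been removed as long as there are any. The partner \<open>j\<close> of \<open>i\<close>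
  can be taken in \<open>E'\<close>; the sets \<open>X\<close>, \<open>Y\<close> are as \<open>{i, j}\<close> and \<open>E - {i, j}\<close> as far as
  their weights are concerned.
\<close>

lemma weighted_exchange:
  fixes \<sigma> :: "'e \<Rightarrow> 'a :: ab_group_add"
  assumes "even_exchange D f" "{} \<in> D" "E \<in> D" "i \<in> E"
  shows "\<exists>E' j X Y. E' \<subseteq> E \<and> i \<in> E' \<and> j \<in> E' - {i} \<and> sum \<sigma> E' = sum \<sigma> E \<and>
     (\<forall>a\<in>E' - {i}. \<forall>b\<in>E' - {i}. a \<noteq> b \<longrightarrow> \<sigma> a + \<sigma> b \<noteq> 0) \<and>
     X \<in> D \<and> Y \<in> D \<and> sum \<sigma> X = \<sigma> i + \<sigma> j \<and> sum \<sigma> Y = sum \<sigma> E - (\<sigma> i + \<sigma> j) \<and>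
     f X + f Y \<le> f {} + f E"
  using assms
proof (induction "card E" arbitrary: E D f rule: less_induct)
  case less
  have fin: "finite X" if "X \<in> D" for X using less.prems(1) that by (auto simp: even_exchange_def)
  show ?case
  proof (cases "\<exists>a\<in>E - {i}. \<exists>b\<in>E - {i}. a \<noteq> b \<and> \<sigma> a + \<sigma> b = 0")
    case False
    obtain j where j: "j \<in> E - {i}" "exch D f {} E i j"
      using less.prems unfolding even_exchange_def by (metis sd_self(3))
    have e: "{i, j} \<in> D" "E - {i, j} \<in> D" "f {i, j} + f (E - {i, j}) \<le> f {} + f E"
      using exch_nested[of "{}" E i j D f] j less.prems by auto
    have "sum \<sigma> {i, j} = \<sigma> i + \<sigma> j" using j(1) by auto
    moreover have "sum \<sigma> (E - {i, j}) = sum \<sigma> E - sum \<sigma> {i, j}"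
      using j(1) less.prems fin by (intro sum_diff) auto
    ultimately show ?thesis using False e j(1) less.prems
      by (intro exI[of _ E] exI[of _ j] exI[of _ "{i, j}"] exI[of _ "E - {i, j}"]) auto
  next
    case True
    then obtain a b where ab: "a \<in> E - {i}" "b \<in> E - {i}" "a \<noteq> b" "\<sigma> a + \<sigma> b = 0" by blast
    define F where "F = E - {a, b}"
    have sumR: "sum \<sigma> R = sum \<sigma> S" if "R = S \<or> R = S \<triangle> {a, b}" "a \<notin> S" "b \<notin> S" "finite R" for R S
    proof (cases "R = S")
      case False
      then have "R = insert a (insert b S)" using that by (auto simp: set_eq_iff)
      then show ?thesis using that ab by (simp add: add.assoc[symmetric])
    qed auto
    have EF: "E = F \<triangle> {a, b}" using ab by (auto simp: F_def set_eq_iff)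
    have F: "F \<in> contract a b D" "contract_fun a b D f F \<le> f E"
      using contract_memI[of E F a b D] contract_fun_le[of E F a b D f] disjI2[OF EF] less.prems(3)
      by (auto simp: F_def)
    have z: "{} \<in> contract a b D" "contract_fun a b D f {} \<le> f {}"
      using contract_memI[of "{}" "{}" a b D] contract_fun_le[of "{}" "{}" a b D f] less.prems by auto
    have sF: "sum \<sigma> E = sum \<sigma> F" using sumR[of E F, OF disjI2[OF EF]] fin less.prems(3) by (auto simp: F_def)
    have "card F < card E" using ab fin[OF less.prems(3)] unfolding F_def by (intro psubset_card_mono) blast+
    from less.hyps[OF this even_exchange_contract[OF less.prems(1) ab(3)] z(1) F(1)]
    obtain E' j X Y where h: "E' \<subseteq> F" "i \<in> E'" "j \<in> E' - {i}" "sum \<sigma> E' = sum \<sigma> F"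
      "\<forall>a\<in>E' - {i}. \<forall>b\<in>E' - {i}. a \<noteq> b \<longrightarrow> \<sigma> a + \<sigma> b \<noteq> 0"
      "X \<in> contract a b D" "Y \<in> contract a b D" "sum \<sigma> X = \<sigma> i + \<sigma> j" "sum \<sigma> Y = sum \<sigma> F - (\<sigma> i + \<sigma> j)"
      "contract_fun a b D f X + contract_fun a b D f Y \<le> contract_fun a b D f {} + contract_fun a b D f F"
      using ab less.prems(4) by (auto simp: F_def)
    obtain RX where RX: "RX = X \<or> RX = X \<triangle> {a, b}" "RX \<in> D" "f RX = contract_fun a b D f X"
      using contract_rep[OF h(6)] by metis
    obtain RY where RY: "RY = Y \<or> RY = Y \<triangle> {a, b}" "RY \<in> D" "f RY = contract_fun a b D f Y"
      using contract_rep[OF h(7)] by metis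
    have sR: "sum \<sigma> RX = sum \<sigma> X" "sum \<sigma> RY = sum \<sigma> Y"
      using sumR[OF RX(1)] sumR[OF RY(1)] fin RX(2) RY(2) h(6,7) by (auto simp: contract_def)
    have "f RX + f RY \<le> f {} + f E" using h(10) RX(3) RY(3) z(2) F(2) by linarith
    moreover have "sum \<sigma> RX = \<sigma> i + \<sigma> j" "sum \<sigma> RY = sum \<sigma> E - (\<sigma> i + \<sigma> j)" "sum \<sigma> E' = sum \<sigma> E"
      using sR h(4,8,9) sF by simp_all
    moreover have "E' \<subseteq> E" using h(1) by (auto simp: F_def)
    ultimately show ?thesis using h(2,3,5) RX(2) RY(2) by (intro exI conjI)
  qed
qed

section \<open>Vectors as sets of unit steps\<close>

lemma sum_sd:
  fixes \<tau> :: "'e \<Rightarrow> 'a :: ab_group_add"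
  assumes "finite V" "A \<subseteq> V" "X \<subseteq> V"
  shows "sum \<tau> (A \<triangle> X) = sum \<tau> A + (\<Sum>e\<in>X. if e \<in> A then - \<tau> e else \<tau> e)"
proof -
  have *: "sum g S = (\<Sum>e\<in>V. if e \<in> S then g e else 0)" if "S \<subseteq> V" for S and g :: "'e \<Rightarrow> 'a"
    using that assms(1) by (simp add: sum.inter_restrict[symmetric] Int_absorb1)
  have "A \<triangle> X \<subseteq> V" using assms by (auto simp: sd_def)
  then show ?thesis
    unfolding *[OF assms(2)] *[OF assms(3)] *[OF \<open>A \<triangle> X \<subseteq> V\<close>] sum.distrib[symmetric]
    by (intro sum.cong) auto
qed

text \<open>
  An \<open>(x, y)\<close>-increment is a signed unit vector whose sign is that of \<open>y - x\<close> in its coordinate.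
\<close>

lemma is_increment_iff:
  "is_increment x y s \<longleftrightarrow> (\<exists>k c. (c = 1 \<or> c = - 1) \<and> s = axis k c \<and> c * (y $ k - x $ k) \<ge> 1)"
proof -
  have neg: "- axis k 1 = axis k (- 1 :: int)" for k by (simp add: vec_eq_iff axis_def)
  have box: "x + axis k c \<in> {vec_meet x y..vec_join x y} \<longleftrightarrow> c * (y $ k - x $ k) \<ge> 1"
    if "c = 1 \<or> c = - 1" for k c
  proof -
    have "x + axis k c \<in> {vec_meet x y..vec_join x y} \<longleftrightarrow>
       (\<forall>j. min (x $ j) (y $ j) \<le> x $ j + axis k c $ j \<and> x $ j + axis k c $ j \<le> max (x $ j) (y $ j))"
      by (auto simp: less_eq_vec_def vec_meet_def vec_join_def)
    also have "\<dots> \<longleftrightarrow> min (x $ k) (y $ k) \<le> x $ k + c \<and> x $ k + c \<le> max (x $ k) (y $ k)"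
      by (auto simp: axis_def)
    also have "\<dots> \<longleftrightarrow> c * (y $ k - x $ k) \<ge> 1"
      using that by auto
    finally show ?thesis .
  qed
  have "is_increment x y s \<longleftrightarrow>
     (\<exists>k c. (c = 1 \<or> c = - 1) \<and> s = axis k c \<and> x + axis k c \<in> {vec_meet x y..vec_join x y})"
    unfolding is_increment_def neg by metis
  also have "\<dots> \<longleftrightarrow> (\<exists>k c. (c = 1 \<or> c = - 1) \<and> s = axis k c \<and> c * (y $ k - x $ k) \<ge> 1)"
    using box by (intro ex_cong1) (simp cong: conj_cong)
  finally show ?thesis .
qed

text \<open>
  A set \<open>A\<close> of unit steps stands for the vector \<open>x + sum \<tau> A\<close>. Flipping \<open>e \<in> A \<triangle> B\<close> either is an
  increment towards the vector of \<open>B\<close>, so that jump M-natural-convexity applies, or some other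
  element of \<open>A \<triangle> B\<close> contributes the opposite step and flipping both changes nothing.
\<close>

lemma natural_exchange_split:
  fixes f :: "int ^ 'n \<Rightarrow> ereal" and \<tau> :: "'e \<Rightarrow> int ^ 'n"
  assumes f: "jump_Mnat_convex f" and V: "finite V"
    and unit: "\<And>e. e \<in> V \<Longrightarrow> \<exists>k c. (c = 1 \<or> c = - 1) \<and> \<tau> e = axis k c"
  shows "natural_exchange {A. A \<subseteq> V \<and> x + sum \<tau> A \<in> eff_dom f} (\<lambda>A. real_of_ereal (f (x + sum \<tau> A)))"
    (is "natural_exchange ?D ?F")
  unfolding natural_exchange_def
proof (intro conjI ballI)
  fix A assume "A \<in> ?D" then show "finite A" using V finite_subset by auto
next
  fix A B e assume A: "A \<in> ?D" and B: "B \<in> ?D" and e: "e \<in> A \<triangle> B"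
  \<comment> \<open>The step that flipping g causes in the vector of A; it is the opposite one in that of B.\<close>
  define \<delta> where "\<delta> g = (if g \<in> A then - \<tau> g else \<tau> g)" for g
  define a where "a = x + sum \<tau> A"
  define b where "b = x + sum \<tau> B"
  have AV: "A \<subseteq> V" "B \<subseteq> V" "A \<triangle> B \<subseteq> V" using A B by (auto simp: sd_def)
  have fin: "finite (A \<triangle> B)" using AV V finite_subset by blast
  have stepA: "x + sum \<tau> (A \<triangle> X) = a + sum \<delta> X" if "X \<subseteq> A \<triangle> B" for X
    using sum_sd[OF V AV(1), of X \<tau>] that AV unfolding \<delta>_def a_def by (simp add: add.assoc)
  have stepB: "x + sum \<tau> (B \<triangle> X) = b - sum \<delta> X" if X: "X \<subseteq> A \<triangle> B" for X
  proof -
    have "(\<Sum>g\<in>X. if g \<in> B then - \<tau> g else \<tau> g) = (\<Sum>g\<in>X. - \<delta> g)"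
      using X by (intro sum.cong) (auto simp: \<delta>_def)
    then show ?thesis
      using sum_sd[OF V AV(2), of X \<tau>] X AV unfolding b_def by (simp add: sum_negf add.assoc)
  qed
  have ba: "sum \<delta> (A \<triangle> B) = b - a"
    using stepA[of "A \<triangle> B"] unfolding b_def by simp
  have sub: "A \<triangle> X \<subseteq> V" "B \<triangle> X \<subseteq> V" if "X \<subseteq> A \<triangle> B" for X
    using that AV by (auto simp: sd_def)
  have \<delta>unit: "\<exists>k c. (c = 1 \<or> c = - 1) \<and> \<delta> g = axis k c" if "g \<in> A \<triangle> B" for g
  proof -
    have "g \<in> V" using that AV(3) by (rule rev_subsetD)
    from unit[OF this] obtain k c where kc: "c = 1 \<or> c = - 1" "\<tau> g = axis k c" by (elim exE conjE)
    have "\<delta> g = axis k (if g \<in> A then - c else c)"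
      unfolding \<delta>_def kc(2) by (simp add: vec_eq_iff axis_def)
    then show ?thesis using kc(1) by (intro exI[of _ k] exI[of _ "if g \<in> A then - c else c"]) auto
  qed
  have fab: "a \<in> eff_dom f" "b \<in> eff_dom f" using A B by (auto simp: a_def b_def)
  have toreal: "real_of_ereal (f u) + real_of_ereal (f v) \<le> real_of_ereal (f a) + real_of_ereal (f b)"
    if "u \<in> eff_dom f" "v \<in> eff_dom f" "f u + f v \<le> f a + f b" for u v
  proof -
    have "\<bar>f w\<bar> \<noteq> \<infinity>" if "w \<in> eff_dom f" for w
      using f that by (auto simp: jump_Mnat_convex_def eff_dom_def)
    then obtain ra rb ru rv where "f a = ereal ra" "f b = ereal rb" "f u = ereal ru" "f v = ereal rv"
      using fab \<open>u \<in> eff_dom f\<close> \<open>v \<in> eff_dom f\<close> by (metis ereal_real')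
    then show ?thesis using that(3) by simp
  qed
  have good: "exch ?D ?F A B e g"
    if "g \<in> A \<triangle> B" "a + sum \<delta> {e, g} \<in> eff_dom f" "b - sum \<delta> {e, g} \<in> eff_dom f"
      "f (a + sum \<delta> {e, g}) + f (b - sum \<delta> {e, g}) \<le> f a + f b" for g
  proof -
    have X: "{e, g} \<subseteq> A \<triangle> B" using e that(1) by blast
    show ?thesis
      unfolding exch_def mem_Collect_eq stepA[OF X] stepB[OF X] a_def[symmetric] b_def[symmetric]
      using toreal[OF that(2,3,4)] sub[OF X] that(2,3) by blast
  qed
  obtain k c where kc: "c = 1 \<or> c = - 1" "\<delta> e = axis k c" using \<delta>unit[OF e] by blast
  have rest: "sum \<delta> (A \<triangle> B - {e}) = b - a - \<delta> e" using e fin by (simp add: sum_diff1 ba del: mem_sd)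
  have find: "\<exists>g\<in>A \<triangle> B - {e}. \<delta> g = axis l d"
    if d: "d = 1 \<or> d = - 1" and pos: "d * ((b - a - \<delta> e) $ l) \<ge> 1" for l d
  proof -
    have "\<exists>g\<in>A \<triangle> B - {e}. d * (\<delta> g $ l) > 0"
    proof (rule ccontr)
      assume "\<not> ?thesis"
      then have "(\<Sum>g\<in>A \<triangle> B - {e}. d * (\<delta> g $ l)) \<le> 0" by (intro sum_nonpos) force
      also have "(\<Sum>g\<in>A \<triangle> B - {e}. d * (\<delta> g $ l)) = d * ((b - a - \<delta> e) $ l)"
        unfolding rest[symmetric] by (simp add: sum_distrib_left)
      finally show False using pos by simp
    qed
    then obtain g where g: "g \<in> A \<triangle> B - {e}" "d * (\<delta> g $ l) > 0" by blast
    obtain k' c' where "c' = 1 \<or> c' = - 1" "\<delta> g = axis k' c'" using \<delta>unit[of g] g(1) by blast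
    then have "\<delta> g = axis l d" using g(2) d by (auto simp: axis_def split: if_splits)
    then show ?thesis using g(1) by blast
  qed
  show "\<exists>g\<in>A \<triangle> B. exch ?D ?F A B e g"
  proof (cases "c * ((b - a) $ k) \<ge> 1")
    case True
    then have inc: "is_increment a b (\<delta> e)" unfolding is_increment_iff kc(2) using kc(1) by auto
    have "JMnat_EXC f" using f by (simp add: jump_Mnat_convex_def)
    then consider "a + \<delta> e \<in> eff_dom f" "b - \<delta> e \<in> eff_dom f" "f (a + \<delta> e) + f (b - \<delta> e) \<le> f a + f b"
      | t where "is_increment (a + \<delta> e) b t" "a + \<delta> e + t \<in> eff_dom f" "b - \<delta> e - t \<in> eff_dom f"
         "f (a + \<delta> e + t) + f (b - \<delta> e - t) \<le> f a + f b"
      using fab inc unfolding JMnat_EXC_def by blast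
    then show ?thesis
    proof cases
      case 1
      then have "exch ?D ?F A B e e" using good[OF e] by simp
      then show ?thesis using e by blast
    next
      case 2
      obtain l d where ld: "d = 1 \<or> d = - 1" "t = axis l d" "d * (b $ l - (a + \<delta> e) $ l) \<ge> 1"
        using 2(1) unfolding is_increment_iff by blast
      have "d * ((b - a - \<delta> e) $ l) \<ge> 1" using ld(3) by (simp add: algebra_simps)
      from find[OF ld(1) this] obtain g where g: "g \<in> A \<triangle> B - {e}" "\<delta> g = t" using ld(2) by blast
      then have "sum \<delta> {e, g} = \<delta> e + t" by auto
      then have "exch ?D ?F A B e g" using good[of g] 2 g(1) by (simp add: algebra_simps)
      then show ?thesis using g(1) by blast
    qed
  next
    case False
    have "- c = 1 \<or> - c = - 1" "- c * ((b - a - \<delta> e) $ k) \<ge> 1" using False kc by (auto simp: axis_def)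
    from find[OF this] obtain g where g: "g \<in> A \<triangle> B - {e}" "\<delta> g = axis k (- c)" by blast
    have "sum \<delta> {e, g} = \<delta> e + \<delta> g" using g(1) by auto
    also have "\<dots> = 0" unfolding kc(2) g(2) by (simp add: vec_eq_iff axis_def)
    finally have "sum \<delta> {e, g} = 0" .
    then have "exch ?D ?F A B e g" using good[of g] g(1) fab by simp
    then show ?thesis using g(1) by blast
  qed
qed

lemma natural_exchange_product:
  assumes D: "natural_exchange D F" "\<And>A. A \<in> D \<Longrightarrow> A \<subseteq> V" and G: "natural_exchange D' F'" "\<And>A. A \<in> D' \<Longrightarrow> A \<subseteq> V'"
    and V: "V \<inter> V' = {}"
  shows "natural_exchange {A. A \<subseteq> V \<union> V' \<and> A \<inter> V \<in> D \<and> A \<inter> V' \<in> D'} (\<lambda>A. F (A \<inter> V) + F' (A \<inter> V'))"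
    (is "natural_exchange ?D ?F")
  unfolding natural_exchange_def
proof (intro conjI ballI)
  fix A assume A: "A \<in> ?D"
  then have "A = (A \<inter> V) \<union> (A \<inter> V')" by blast
  moreover have "finite (A \<inter> V)" "finite (A \<inter> V')" using A D(1) G(1) by (auto simp: natural_exchange_def)
  ultimately show "finite A" by (metis finite_Un)
next
  fix A B e assume A: "A \<in> ?D" and B: "B \<in> ?D" and e: "e \<in> A \<triangle> B"
  have int: "(S \<inter> W) \<triangle> (T \<inter> W) = (S \<triangle> T) \<inter> W" for S T W :: "'a set" by (auto simp: set_eq_iff)
  have i1: "(S \<triangle> {e, j}) \<inter> W = (S \<inter> W) \<triangle> {e, j}" if "e \<in> W" "j \<in> W" for S W j
    using that by (auto simp: set_eq_iff)
  have i2: "(S \<triangle> {e, j}) \<inter> W' = S \<inter> W'" if "e \<in> W" "j \<in> W" "W \<inter> W' = {}" for S W W' j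
    using that by (auto simp: set_eq_iff)
  consider "e \<in> V" | "e \<in> V'" using e A B by auto
  then show "\<exists>j\<in>A \<triangle> B. exch ?D ?F A B e j"
  proof cases
    case 1
    then obtain j where j: "j \<in> A \<triangle> B" "j \<in> V" "exch D F (A \<inter> V) (B \<inter> V) e j"
      using D(1) A B e unfolding natural_exchange_def int by (metis (no_types, lifting) IntD1 IntD2 IntI int mem_Collect_eq)
    have "exch ?D ?F A B e j"
      using j(3) A B D(2) 1 j(2) V unfolding exch_def mem_Collect_eq i1[OF 1 j(2)] i2[OF 1 j(2) V]
      by (auto simp: sd_def)
    then show ?thesis using j(1) by blast
  next
    case 2
    then obtain j where j: "j \<in> A \<triangle> B" "j \<in> V'" "exch D' F' (A \<inter> V') (B \<inter> V') e j"
      using G(1) A B e unfolding natural_exchange_def int by (metis (no_types, lifting) IntD1 IntD2 IntI int mem_Collect_eq)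
    have V': "V' \<inter> V = {}" using V by blast
    have "exch ?D ?F A B e j"
      using j(3) A B G(2) 2 j(2) V unfolding exch_def mem_Collect_eq i1[OF 2 j(2)] i2[OF 2 j(2) V']
      by (auto simp: sd_def)
    then show ?thesis using j(1) by blast
  qed
qed

text \<open>
  The vector \<open>d\<close> is the sum of its unit steps: \<open>\<bar>d $ k\<bar>\<close> copies in coordinate \<open>k\<close>, told apart by
  \<open>c\<close>. The tag \<open>m\<close> keeps the steps of the two summands of a convolution disjoint.
\<close>

lemma sum_signed_units:
  fixes d :: "int ^ 'n" and m :: nat
  shows "(\<Sum>(m', k, c)\<in>{m} \<times> (SIGMA k:UNIV. {..<nat \<bar>d $ k\<bar>}). axis k (sgn (d $ k))) = d"
proof -
  have "(\<Sum>(m', k, c)\<in>{m} \<times> (SIGMA k:UNIV. {..<nat \<bar>d $ k\<bar>}). axis k (sgn (d $ k))) =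
      (\<Sum>(k, c)\<in>(SIGMA k:UNIV. {..<nat \<bar>d $ k\<bar>}). axis k (sgn (d $ k)))"
    by (simp add: sum.cartesian_product[symmetric])
  also have "\<dots> = (\<Sum>k\<in>UNIV. \<Sum>c<nat \<bar>d $ k\<bar>. axis k (sgn (d $ k)))"
    by (subst sum.Sigma) auto
  also have "\<dots> = d"
  proof (rule iffD2[OF vec_eq_iff], rule allI)
    fix j
    have "(\<Sum>k\<in>UNIV. \<Sum>c<nat \<bar>d $ k\<bar>. axis k (sgn (d $ k))) $ j =
       (\<Sum>k\<in>UNIV. if k = j then \<bar>d $ j\<bar> * sgn (d $ j) else 0)"
      unfolding sum_component by (intro sum.cong) (auto simp: axis_def)
    also have "\<dots> = d $ j" by (simp add: abs_mult_sgn)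
    finally show "(\<Sum>k\<in>UNIV. \<Sum>c<nat \<bar>d $ k\<bar>. axis k (sgn (d $ k))) $ j = d $ j" .
  qed
  finally show ?thesis .
qed

section \<open>The convolution\<close>

lemma exchange_of_representations:
  fixes f1 f2 :: "int ^ 'n \<Rightarrow> ereal"
  assumes f: "jump_Mnat_convex f1" "jump_Mnat_convex f2"
    and x: "x1 \<in> eff_dom f1" "x2 \<in> eff_dom f2" and y: "y1 \<in> eff_dom f1" "y2 \<in> eff_dom f2"
    and s: "is_increment (x1 + x2) (y1 + y2) s"
  shows "\<exists>t u1 u2 v1 v2. (t = 0 \<or> is_increment (x1 + x2 + s) (y1 + y2) t) \<and>
     u1 + u2 = x1 + x2 + s + t \<and> v1 + v2 = y1 + y2 - s - t \<and>
     f1 u1 + f2 u2 + (f1 v1 + f2 v2) \<le> f1 x1 + f2 x2 + (f1 y1 + f2 y2)"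
proof -
  define d where "d m = (if m = 0 then y1 - x1 else y2 - x2)" for m :: nat
  define V where "V m = {m} \<times> (SIGMA k:UNIV. {..<nat \<bar>d m $ k\<bar>})" for m :: nat
  define \<tau> where "\<tau> = (\<lambda>(m, k :: 'n, c :: nat). if m < 2 then axis k (sgn (d m $ k)) else 0)"
  \<comment> \<open>The tag 2 makes z, the parity element, different from all unit steps.\<close>
  define z where "z = (2 :: nat, undefined :: 'n, 0 :: nat)"
  have fV: "finite (V m)" for m unfolding V_def by (intro finite_SigmaI finite.intros) auto
  have zV: "z \<notin> V 0 \<union> V 1" by (auto simp: z_def V_def)
  have \<tau>z: "\<tau> z = 0" by (simp add: z_def \<tau>_def)
  have disj: "V 0 \<inter> V 1 = {}" by (auto simp: V_def)
  have unit: "\<exists>k c. (c = 1 \<or> c = - 1) \<and> \<tau> e = axis k c" if "e \<in> V m" "m < 2" for e m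
  proof -
    obtain k c where e: "e = (m, k, c)" "d m $ k \<noteq> 0" using \<open>e \<in> V m\<close> by (force simp: V_def)
    then have "\<tau> e = axis k (sgn (d m $ k))" using \<open>m < 2\<close> by (simp add: \<tau>_def)
    then show ?thesis using e(2) by (intro exI[of _ k] exI[of _ "sgn (d m $ k)"]) (auto simp: sgn_if)
  qed
  have sumV: "sum \<tau> (V m) = d m" if "m < 2" for m
  proof -
    have "sum \<tau> (V m) = (\<Sum>(m', k, c)\<in>V m. axis k (sgn (d m $ k)))"
      by (intro sum.cong) (use that in \<open>auto simp: \<tau>_def V_def\<close>)
    then show ?thesis unfolding V_def sum_signed_units .
  qed
  define D1 where "D1 = {A. A \<subseteq> V 0 \<and> x1 + sum \<tau> A \<in> eff_dom f1}"
  define D2 where "D2 = {A. A \<subseteq> V 1 \<and> x2 + sum \<tau> A \<in> eff_dom f2}"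
  define F1 where "F1 A = real_of_ereal (f1 (x1 + sum \<tau> A))" for A
  define F2 where "F2 A = real_of_ereal (f2 (x2 + sum \<tau> A))" for A
  define D where "D = {A. A \<subseteq> V 0 \<union> V 1 \<and> A \<inter> V 0 \<in> D1 \<and> A \<inter> V 1 \<in> D2}"
  define F where "F A = F1 (A \<inter> V 0) + F2 (A \<inter> V 1)" for A
  have "natural_exchange D1 F1" "natural_exchange D2 F2"
    using natural_exchange_split[OF f(1) fV[of 0], of \<tau> x1] natural_exchange_split[OF f(2) fV[of 1], of \<tau> x2] unit
    unfolding D1_def D2_def F1_def F2_def by auto
  then have "natural_exchange D F"
    unfolding D_def F_def using disj by (intro natural_exchange_product) (auto simp: D1_def D2_def)
  then have even: "even_exchange (evenize z D) (\<lambda>X. F (X - {z}))"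
    using zV by (intro even_exchange_evenize) (auto simp: D_def)
  define W where "W = V 0 \<union> V 1"
  define E where "E = (if even (card W) then W else insert z W)"
  have W: "finite W" "z \<notin> W" "W \<inter> V 0 = V 0" "W \<inter> V 1 = V 1" using fV zV by (auto simp: W_def)
  have EW: "E - {z} = W" using W by (auto simp: E_def)
  have sumW: "sum \<tau> W = (y1 + y2) - (x1 + x2)"
    unfolding W_def using sum.union_disjoint[OF fV fV disj, of \<tau>] sumV by (simp add: d_def)
  have sumE: "sum \<tau> E = (y1 + y2) - (x1 + x2)"
    using sumW W \<tau>z by (simp add: E_def)
  have D0: "{} \<in> evenize z D" using x by (auto simp: evenize_def D_def D1_def D2_def)
  have "W \<in> D" using y W sumV unfolding D_def D1_def D2_def by (auto simp: W_def d_def)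
  then have DE: "E \<in> evenize z D" using W by (auto simp: evenize_def E_def)
  obtain k c where kc: "c = 1 \<or> c = - 1" "s = axis k c" "c * ((y1 + y2) $ k - (x1 + x2) $ k) \<ge> 1"
    using s unfolding is_increment_iff by blast
  have unitE: "e = z \<or> (\<exists>k c. (c = 1 \<or> c = - 1) \<and> \<tau> e = axis k c)" if "e \<in> E" for e
    using that unit[of e 0] unit[of e 1] by (auto simp: E_def W_def split: if_splits)
  have "\<exists>i\<in>E. c * (\<tau> i $ k) > 0"
  proof (rule ccontr)
    assume "\<not> ?thesis"
    then have "(\<Sum>i\<in>E. c * (\<tau> i $ k)) \<le> 0" by (intro sum_nonpos) force
    also have "(\<Sum>i\<in>E. c * (\<tau> i $ k)) = c * (sum \<tau> E $ k)" by (simp add: sum_distrib_left)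
    finally show False using kc(3) unfolding sumE by simp
  qed
  then obtain i where i: "i \<in> E" "c * (\<tau> i $ k) > 0" by blast
  have \<tau>i: "\<tau> i = s"
    using unitE[OF i(1)] i(2) kc(1,2) \<tau>z by (auto simp: axis_def split: if_splits)
  obtain E' j X Y where h: "E' \<subseteq> E" "i \<in> E'" "j \<in> E' - {i}" "sum \<tau> E' = sum \<tau> E"
     "\<forall>a\<in>E' - {i}. \<forall>b\<in>E' - {i}. a \<noteq> b \<longrightarrow> \<tau> a + \<tau> b \<noteq> 0"
     "X \<in> evenize z D" "Y \<in> evenize z D" "sum \<tau> X = \<tau> i + \<tau> j" "sum \<tau> Y = sum \<tau> E - (\<tau> i + \<tau> j)"
     "F (X - {z}) + F (Y - {z}) \<le> F ({} - {z}) + F (E - {z})"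
    using weighted_exchange[OF even D0 DE i(1), of \<tau>] by blast
  define t where "t = \<tau> j"
  have fE': "finite E'" using h(1) W(1) finite_subset by (auto simp: E_def split: if_splits)
  have tinc: "t = 0 \<or> is_increment (x1 + x2 + s) (y1 + y2) t"
  proof (cases "j = z")
    case True then show ?thesis using \<tau>z t_def by simp
  next
    case False
    then obtain l e where le: "e = 1 \<or> e = - 1" "t = axis l e" using unitE[of j] h(1,3) t_def by blast
    \<comment> \<open>A step of E' opposite to t would cancel against j, so all steps in coordinate l agree with t.\<close>
    have nonneg: "e * (\<tau> g $ l) \<ge> 0" if g: "g \<in> E' - {i}" for g
    proof (rule ccontr)
      assume neg: "\<not> ?thesis"
      then have "g \<noteq> z" using \<tau>z by auto
      then obtain l' e' where "e' = 1 \<or> e' = - 1" "\<tau> g = axis l' e'" using unitE[of g] h(1) g by blast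
      then have "\<tau> g + \<tau> j = 0" "g \<noteq> j"
        using neg le unfolding t_def by (auto simp: axis_def vec_eq_iff split: if_splits)
      then show False using h(3,5) g by blast
    qed
    have "1 = e * (\<tau> j $ l)" using le unfolding t_def by auto
    also have "\<dots> \<le> (\<Sum>g\<in>E' - {i}. e * (\<tau> g $ l))"
      using h(3) nonneg fE' by (intro member_le_sum) auto
    also have "\<dots> = e * (sum \<tau> (E' - {i}) $ l)" by (simp add: sum_distrib_left)
    also have "sum \<tau> (E' - {i}) = (y1 + y2) - (x1 + x2) - s"
      using h(2,4) fE' \<tau>i sumE by (simp add: sum_diff1)
    finally show ?thesis unfolding is_increment_iff le(2) using le(1)
      by (intro disjI2 exI[of _ l] exI[of _ e]) (simp add: algebra_simps)
  qed
  have rep: "\<exists>u1 u2. u1 + u2 = x1 + x2 + sum \<tau> S \<and> u1 \<in> eff_dom f1 \<and> u2 \<in> eff_dom f2 \<and>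
     F (S - {z}) = real_of_ereal (f1 u1) + real_of_ereal (f2 u2)" if S: "S \<in> evenize z D" for S
  proof (intro exI conjI)
    define R where "R = S - {z}"
    have R: "R \<in> D" "finite S" using S by (auto simp: evenize_def R_def)
    then have "R = (R \<inter> V 0) \<union> (R \<inter> V 1)" by (auto simp: D_def)
    then have "sum \<tau> R = sum \<tau> (R \<inter> V 0) + sum \<tau> (R \<inter> V 1)"
      using sum.union_disjoint[of "R \<inter> V 0" "R \<inter> V 1" \<tau>] fV disj by auto
    moreover have "sum \<tau> R = sum \<tau> S" unfolding R_def using R(2) \<tau>z by (simp add: sum_diff1)
    ultimately show "(x1 + sum \<tau> (R \<inter> V 0)) + (x2 + sum \<tau> (R \<inter> V 1)) = x1 + x2 + sum \<tau> S"
      by (simp add: algebra_simps)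
    show "x1 + sum \<tau> (R \<inter> V 0) \<in> eff_dom f1" "x2 + sum \<tau> (R \<inter> V 1) \<in> eff_dom f2"
      using R(1) by (auto simp: D_def D1_def D2_def)
    show "F (S - {z}) = real_of_ereal (f1 (x1 + sum \<tau> (R \<inter> V 0))) + real_of_ereal (f2 (x2 + sum \<tau> (R \<inter> V 1)))"
      by (simp add: F_def F1_def F2_def R_def)
  qed
  obtain u1 u2 where u: "u1 + u2 = x1 + x2 + sum \<tau> X" "u1 \<in> eff_dom f1" "u2 \<in> eff_dom f2"
     "F (X - {z}) = real_of_ereal (f1 u1) + real_of_ereal (f2 u2)" using rep[OF h(6)] by blast
  obtain v1 v2 where v: "v1 + v2 = x1 + x2 + sum \<tau> Y" "v1 \<in> eff_dom f1" "v2 \<in> eff_dom f2"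
     "F (Y - {z}) = real_of_ereal (f1 v1) + real_of_ereal (f2 v2)" using rep[OF h(7)] by blast
  have F0: "F ({} - {z}) = real_of_ereal (f1 x1) + real_of_ereal (f2 x2)"
    by (simp add: F_def F1_def F2_def)
  have FE: "F (E - {z}) = real_of_ereal (f1 y1) + real_of_ereal (f2 y2)"
    unfolding EW using W sumV by (simp add: F_def F1_def F2_def d_def)
  have fin: "f1 w = ereal (real_of_ereal (f1 w))" if "w \<in> eff_dom f1" for w
    using f(1) that by (auto simp: jump_Mnat_convex_def eff_dom_def ereal_real)
  have fin2: "f2 w = ereal (real_of_ereal (f2 w))" if "w \<in> eff_dom f2" for w
    using f(2) that by (auto simp: jump_Mnat_convex_def eff_dom_def ereal_real)
  have "f1 u1 + f2 u2 + (f1 v1 + f2 v2) = ereal (F (X - {z}) + F (Y - {z}))"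
    using fin[OF u(2)] fin2[OF u(3)] fin[OF v(2)] fin2[OF v(3)] u(4) v(4) by (metis plus_ereal.simps(1))
  also have "\<dots> \<le> ereal (F ({} - {z}) + F (E - {z}))" using h(10) by simp
  also have "\<dots> = f1 x1 + f2 x2 + (f1 y1 + f2 y2)"
    using fin[OF x(1)] fin2[OF x(2)] fin[OF y(1)] fin2[OF y(2)] F0 FE by (metis plus_ereal.simps(1))
  finally have "f1 u1 + f2 u2 + (f1 v1 + f2 v2) \<le> f1 x1 + f2 x2 + (f1 y1 + f2 y2)" .
  moreover have "u1 + u2 = x1 + x2 + s + t" using u(1) h(8) \<tau>i t_def by (simp add: algebra_simps)
  moreover have "v1 + v2 = y1 + y2 - s - t" using v(1) h(9) \<tau>i t_def sumE by (simp add: algebra_simps)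
  ultimately show ?thesis using tinc by blast
qed

theorem theorem4p7:
  fixes f1 f2 :: "int ^ 'n \<Rightarrow> ereal"
  assumes "jump_Mnat_convex f1"
    and "jump_Mnat_convex f2"
    and "\<forall>x. inf_convolution f1 f2 x \<noteq> -\<infinity>"
  shows "jump_Mnat_convex (inf_convolution f1 f2)"
proof -
  let ?g = "inf_convolution f1 f2"
  have le: "?g (u1 + u2) \<le> f1 u1 + f2 u2" for u1 u2
    unfolding inf_convolution_def by (rule Inf_lower) blast
  have ne: "f1 w \<noteq> -\<infinity>" "f2 w \<noteq> -\<infinity>" for w using assms by (auto simp: jump_Mnat_convex_def)
  have approx: "\<exists>u1 u2. u1 + u2 = x \<and> f1 u1 + f2 u2 < r" if "?g x < r" for x r
    using that unfolding inf_convolution_def Inf_less_iff by blast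
  have dom: "u1 \<in> eff_dom f1 \<and> u2 \<in> eff_dom f2" if "f1 u1 + f2 u2 < r" for u1 u2 r
    using that ne[of u1] ne[of u2] by (cases "f1 u1"; cases "f2 u2") (auto simp: eff_dom_def)
  have "eff_dom ?g \<noteq> {}"
  proof -
    obtain u1 u2 where "u1 \<in> eff_dom f1" "u2 \<in> eff_dom f2" using assms(1,2) by (auto simp: jump_Mnat_convex_def)
    then have "f1 u1 + f2 u2 < \<infinity>" by (auto simp: eff_dom_def)
    then have "u1 + u2 \<in> eff_dom ?g" using le[of u1 u2] unfolding eff_dom_def by (auto intro: le_less_trans)
    then show ?thesis by blast
  qed
  moreover have "JMnat_EXC ?g"
    unfolding JMnat_EXC_def
  proof (intro ballI allI impI)
    fix x y s assume x: "x \<in> eff_dom ?g" and y: "y \<in> eff_dom ?g" and s: "is_increment x y s"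
    obtain rx ry where rx: "?g x = ereal rx" and ry: "?g y = ereal ry"
      using x y assms(3) unfolding eff_dom_def by (metis ereal_cases less_irrefl mem_Collect_eq)
    define T where "T = {t. t = 0 \<or> is_increment (x + s) y t}"
    define h where "h t = ?g (x + s + t) + ?g (y - s - t)" for t
    have "finite T"
    proof (rule finite_subset)
      show "T \<subseteq> insert 0 ((\<lambda>i. axis i 1) ` UNIV \<union> (\<lambda>i. - axis i 1) ` UNIV)"
        by (auto simp: T_def is_increment_def)
    qed auto
    have "T \<noteq> {}" by (auto simp: T_def)
    have "\<exists>t\<in>T. h t \<le> ?g x + ?g y"
    proof (rule ccontr)
      assume "\<not> ?thesis"
      then have gt: "?g x + ?g y < h t" if "t \<in> T" for t using that by force
      define M where "M = Min (h ` T)"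
      have M: "ereal (rx + ry) < M" "\<And>t. t \<in> T \<Longrightarrow> M \<le> h t"
        using \<open>finite T\<close> \<open>T \<noteq> {}\<close> gt rx ry unfolding M_def by auto
      obtain r where r: "ereal (rx + ry) < ereal r" "ereal r < M" using ereal_dense2[OF M(1)] by blast
      \<comment> \<open>Representations within \<epsilon> of the infima have total value below r, hence below every h t.\<close>
      define \<epsilon> where "\<epsilon> = (r - (rx + ry)) / 2"
      have \<epsilon>: "\<epsilon> > 0" "(rx + \<epsilon>) + (ry + \<epsilon>) = r" using r(1) by (auto simp: \<epsilon>_def field_simps)
      obtain x1 x2 where x12: "x1 + x2 = x" "f1 x1 + f2 x2 < ereal (rx + \<epsilon>)"
        using approx[of x "ereal (rx + \<epsilon>)"] rx \<epsilon> by auto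
      obtain y1 y2 where y12: "y1 + y2 = y" "f1 y1 + f2 y2 < ereal (ry + \<epsilon>)"
        using approx[of y "ereal (ry + \<epsilon>)"] ry \<epsilon> by auto
      obtain t u1 u2 v1 v2 where t: "t = 0 \<or> is_increment (x + s) y t"
        "u1 + u2 = x + s + t" "v1 + v2 = y - s - t"
        "f1 u1 + f2 u2 + (f1 v1 + f2 v2) \<le> f1 x1 + f2 x2 + (f1 y1 + f2 y2)"
        using exchange_of_representations[OF assms(1,2), of x1 x2 y1 y2 s] dom x12 y12 s by metis
      have "h t \<le> f1 u1 + f2 u2 + (f1 v1 + f2 v2)"
        unfolding h_def t(2,3)[symmetric] by (intro add_mono le)
      also note t(4)
      also have "f1 x1 + f2 x2 + (f1 y1 + f2 y2) \<le> ereal (rx + \<epsilon>) + ereal (ry + \<epsilon>)"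
        using x12 y12 by (intro add_mono) auto
      also have "\<dots> = ereal r" using \<epsilon> by simp
      also have "\<dots> < M" by (rule r)
      also have "M \<le> h t" using M(2) t(1) by (simp add: T_def)
      finally show False by simp
    qed
    then obtain t where t: "t = 0 \<or> is_increment (x + s) y t" "h t \<le> ?g x + ?g y" by (auto simp: T_def)
    have "h t < \<infinity>" using t(2) rx ry by (auto intro: le_less_trans)
    then have "x + s + t \<in> eff_dom ?g" "y - s - t \<in> eff_dom ?g"
      using assms(3) unfolding h_def eff_dom_def
      by (cases "?g (x + s + t)"; cases "?g (y - s - t)"; auto)+
    then show "(x + s \<in> eff_dom ?g \<and> y - s \<in> eff_dom ?g \<and> ?g (x + s) + ?g (y - s) \<le> ?g x + ?g y) \<or>
        (\<exists>t. is_increment (x + s) y t \<and> x + s + t \<in> eff_dom ?g \<and> y - s - t \<in> eff_dom ?g \<and>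
           ?g (x + s + t) + ?g (y - s - t) \<le> ?g x + ?g y)"
      using t unfolding h_def by auto
  qed
  ultimately show ?thesis using assms(3) by (simp add: jump_Mnat_convex_def)
qed

end
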